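(* Let $Z_1,Z_2,\dots$ be independent standard quaternion Gaussian random variables, and let $X_1,X_2,\dots,X_{2n}$ be chosen, possibly with repetition, from the set $\{Z_1,\overline{Z}_1,Z_2,\overline{Z}_2,\dots\}$. Let $j_1,\dots,j_m$ be natural numbers (positive integers) with $j_1+\dots+j_m=2n$. Let $\mathcal{M}=\mathcal{M}_{j_1,\dots,j_m}(X_1,\dots,X_{2n})$ be the (possibly empty) family of labeled Möbius graphs with $m$ vertices of degrees $j_1,\dots,j_m$ whose half-edges are labeled by $X_1,\dots,X_{2n}$, whose untwisted edges correspond to pairs with $X_i=\overline{X}_j$ and whose twisted edges correspond to pairs with $X_i=X_j$ (no edge joins $X_i,X_j$ that are independent). Then $$\mathbb{E}\Big(\Re(X_1X_2\cdots X_{j_1})\,\Re(X_{j_1+1}\cdots X_{j_1+j_2})\times\cdots\times\Re(X_{j_1+\dots+j_{m-1}+1}\cdots X_{2n})\Big)=4^{\,n-m}\sum_{\Gamma\in\mathcal{M}}(-2)^{\chi(\Gamma)},$$ where $\chi(\Gamma)$ is the Euler characteristic of $\Gamma$ and the right-hand side is interpreted as $0$ when $\mathcal{M}=\emptyset$.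
   Context: Quaternions: $\mathbb{H}\ni q=x_0+ix_1+jx_2+kx_3$ with $i^2=j^2=k^2=ijk=-1$, $x_0,\dots,x_3\in\mathbb{R}$; $\overline q=x_0-ix_1-jx_2-kx_3$; $\Re(q)=(q+\overline q)/2=x_0$. A standard quaternion Gaussian random variable is $Z=\xi_0+i\xi_1+j\xi_2+k\xi_3$ with $\xi_0,\xi_1,\xi_2,\xi_3$ independent real $N(0,1)$ random variables. Choice of $X$'s: formally, for each $i\in\{1,\dots,2n\}$ there is an index $c(i)$ such that $X_i=Z_{c(i)}$ or $X_i=\overline{Z}_{c(i)}$. $X_i$ and $X_j$ are independent iff $c(i)\ne c(j)$. Möbius graphs: vertices are disks with a local orientation; edges are ribbons joining vertices, each either untwisted (regular; preserving the local orientations) or twisted (flipped; reversing the local orientations). Faces are the disjoint cycles of sides of ribbons found by following the sides of the ribbons and the vertex boundaries. The vertices are labeled, and the half-edges emanating from each vertex are labeled, so graphs differing by rotation of a vertex are distinct. Concretely, a labeled Möbius graph with vertices of degrees $j_1,\dots,j_m$, $j_1+\dots+j_m=2n$, is a partition of the set of half-edges $\{1,\dots,2n\}$ into $n$ two-element sets (the edges), together with a designation of each edge as untwisted or twisted; the half-edges at the $r$-th vertex, in cyclic order, are $j_1+\dots+j_{r-1}+1,\dots,j_1+\dots+j_r$. To count faces: each half-edge $i$ has two sides $i^L,i^R$; let $\mathrm{next}(i)$ be the cyclic successor of $i$ at its vertex; join $i^L$ to $\mathrm{next}(i)^R$ for every $i$; for every untwisted edge $\{i,j\}$ join $i^L$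 to $j^R$ and $i^R$ to $j^L$; for every twisted edge $\{i,j\}$ join $i^L$ to $j^L$ and $i^R$ to $j^R$. The result is a 2-regular (multi)graph on $4n$ points, and the number of faces $f(\Gamma)$ is its number of cycles. Euler characteristic: $\chi(\Gamma)=v(\Gamma)-e(\Gamma)+f(\Gamma)$, where $v(\Gamma)=m$, $e(\Gamma)=n$ and $f(\Gamma)$ are the numbers of vertices, edges and faces. (The graph need not be connected; $\chi$ is additive over connected components.) The family $\mathcal{M}$ thus has exactly one element for each pair partition of $\{1,\dots,2n\}$ in which every pair $\{i,j\}$ satisfies $c(i)=c(j)$; the edge $\{i,j\}$ is twisted if $X_i=X_j$ and untwisted if $X_i=\overline{X}_j$. *)

theory Defs
  imports "HOL-Probability.Probability"
begin

section \<open>Quaternions\<close>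

codatatype quat = Quat (qRe: real) (qI: real) (qJ: real) (qK: real)

lemma quat_eq_iff:
  "x = y \<longleftrightarrow> qRe x = qRe y \<and> qI x = qI y \<and> qJ x = qJ y \<and> qK x = qK y"
  by (auto intro: quat.expand)

instantiation quat :: ring_1
begin

primcorec zero_quat where
  "qRe 0 = 0" | "qI 0 = 0" | "qJ 0 = 0" | "qK 0 = 0"

primcorec one_quat where
  "qRe 1 = 1" | "qI 1 = 0" | "qJ 1 = 0" | "qK 1 = 0"

primcorec plus_quat where
  "qRe (x + y) = qRe x + qRe y"
| "qI (x + y) = qI x + qI y"
| "qJ (x + y) = qJ x + qJ y"
| "qK (x + y) = qK x + qK y"

primcorec uminus_quat where
  "qRe (- x) = - qRe x"
| "qI (- x) = - qI x"
| "qJ (- x) = - qJ x"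
| "qK (- x) = - qK x"

primcorec minus_quat where
  "qRe (x - y) = qRe x - qRe y"
| "qI (x - y) = qI x - qI y"
| "qJ (x - y) = qJ x - qJ y"
| "qK (x - y) = qK x - qK y"

primcorec times_quat where
  "qRe (x * y) = qRe x * qRe y - qI x * qI y - qJ x * qJ y - qK x * qK y"
| "qI (x * y) = qRe x * qI y + qI x * qRe y + qJ x * qK y - qK x * qJ y"
| "qJ (x * y) = qRe x * qJ y - qI x * qK y + qJ x * qRe y + qK x * qI y"
| "qK (x * y) = qRe x * qK y + qI x * qJ y - qJ x * qI y + qK x * qRe y"

instance
  by standard (simp_all add: quat_eq_iff algebra_simps)

end

lemma quat_units:
  defines "i \<equiv> Quat 0 1 0 0" and "j \<equiv> Quat 0 0 1 0" and "k \<equiv> Quat 0 0 0 1"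
  shows "i * i = -1" "j * j = -1" "k * k = -1" "i * j * k = -1"
  by (simp_all add: quat_eq_iff i_def j_def k_def)

instantiation quat :: real_algebra_1
begin

primcorec scaleR_quat where
  "qRe (scaleR r x) = r * qRe x"
| "qI (scaleR r x) = r * qI x"
| "qJ (scaleR r x) = r * qJ x"
| "qK (scaleR r x) = r * qK x"

instance
  by standard (simp_all add: quat_eq_iff algebra_simps)

end

(* The Euclidean structure of R^4; it supplies the Borel sigma-algebra on quat. *)

instantiation quat :: real_inner
begin

definition inner_quat :: "quat \<Rightarrow> quat \<Rightarrow> real" where
  "inner_quat x y = qRe x * qRe y + qI x * qI y + qJ x * qJ y + qK x * qK y"

definition norm_quat :: "quat \<Rightarrow> real" where
  "norm_quat x = sqrt (inner x x)"

definition sgn_quat :: "quat \<Rightarrow> quat" where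
  "sgn_quat x = x /\<^sub>R norm x"

definition dist_quat :: "quat \<Rightarrow> quat \<Rightarrow> real" where
  "dist_quat x y = norm (x - y)"

definition uniformity_quat :: "(quat \<times> quat) filter" where
  "uniformity_quat = (INF e\<in>{0 <..}. principal {(x, y). dist x y < e})"

definition open_quat :: "quat set \<Rightarrow> bool" where
  "open_quat U \<longleftrightarrow> (\<forall>x\<in>U. eventually (\<lambda>(x', y). x' = x \<longrightarrow> y \<in> U) uniformity)"

instance
proof
  fix x y z :: quat and r :: real and U :: "quat set"
  show "dist x y = norm (x - y)" by (rule dist_quat_def)
  show "sgn x = x /\<^sub>R norm x" by (rule sgn_quat_def)
  show "(uniformity :: (quat \<times> quat) filter) = (INF e\<in>{0 <..}. principal {(x, y). dist x y < e})"
    by (rule uniformity_quat_def)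
  show "open U \<longleftrightarrow> (\<forall>x\<in>U. eventually (\<lambda>(x', y). x' = x \<longrightarrow> y \<in> U) uniformity)"
    by (rule open_quat_def)
  show "inner x y = inner y x" by (simp add: inner_quat_def mult.commute)
  show "inner (x + y) z = inner x z + inner y z" by (simp add: inner_quat_def algebra_simps)
  show "inner (scaleR r x) y = r * inner x y" by (simp add: inner_quat_def algebra_simps)
  show "0 \<le> inner x x" by (simp add: inner_quat_def)
  show "inner x x = 0 \<longleftrightarrow> x = 0"
    by (simp add: inner_quat_def quat_eq_iff add_nonneg_eq_0_iff)
  show "norm x = sqrt (inner x x)" by (rule norm_quat_def)
qed

end

instantiation quat :: euclidean_space
begin

definition Basis_quat :: "quat set" where
  "Basis_quat = {Quat 1 0 0 0, Quat 0 1 0 0, Quat 0 0 1 0, Quat 0 0 0 1}"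

instance
proof
  fix u v x :: quat
  show "(Basis :: quat set) \<noteq> {}" "finite (Basis :: quat set)"
    by (simp_all add: Basis_quat_def)
  show "inner u v = (if u = v then 1 else 0)" if "u \<in> Basis" "v \<in> Basis"
    using that unfolding Basis_quat_def by (elim insertE) (simp_all add: inner_quat_def)
  show "(\<forall>u\<in>Basis. inner x u = 0) \<longleftrightarrow> x = 0"
    by (simp add: Basis_quat_def inner_quat_def quat_eq_iff [of x 0])
qed

end

primcorec qcnj :: "quat \<Rightarrow> quat" where
  "qRe (qcnj x) = qRe x"
| "qI (qcnj x) = - qI x"
| "qJ (qcnj x) = - qJ x"
| "qK (qcnj x) = - qK x"

definition std_quat_gaussian :: "'a measure \<Rightarrow> ('a \<Rightarrow> quat) \<Rightarrow> bool" where
  "std_quat_gaussian M Z \<longleftrightarrow>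
     (\<exists>\<xi> :: nat \<Rightarrow> 'a \<Rightarrow> real.
        prob_space.indep_vars M (\<lambda>_. borel) \<xi> {0..3} \<and>
        (\<forall>l\<in>{0..3}. distributed M lborel (\<xi> l) std_normal_density) \<and>
        (\<forall>\<omega>\<in>space M. Z \<omega> = Quat (\<xi> 0 \<omega>) (\<xi> 1 \<omega>) (\<xi> 2 \<omega>) (\<xi> 3 \<omega>)))"


section \<open>Labeled Moebius graphs\<close>

(* The half-edges are the numbers 1, ..., sum_list degrees.  For a vertex r < length ds,
   "half_edges ds r" lists its half-edges in cyclic order. *)

definition half_edges :: "nat list \<Rightarrow> nat \<Rightarrow> nat list" where
  "half_edges ds r = [sum_list (take r ds) + 1 ..< sum_list (take (Suc r) ds) + 1]"

record moebius_graph =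
  degrees :: "nat list"
  edges :: "nat set set"
  twisted :: "nat set set"

definition is_moebius_graph :: "moebius_graph \<Rightarrow> bool" where
  "is_moebius_graph G \<longleftrightarrow>
     (\<forall>d\<in>set (degrees G). 0 < d) \<and>
     partition_on {1..sum_list (degrees G)} (edges G) \<and>
     (\<forall>e\<in>edges G. card e = 2) \<and>
     twisted G \<subseteq> edges G"

datatype side = LeftSide | RightSide

definition vertex_joins :: "moebius_graph \<Rightarrow> ((nat \<times> side) \<times> (nat \<times> side)) set" where
  "vertex_joins G =
     {((h ! p, LeftSide), (h ! (Suc p mod length h), RightSide)) | h r p.
        r < length (degrees G) \<and> h = half_edges (degrees G) r \<and> p < length h}"

definition edge_joins :: "moebius_graph \<Rightarrow> ((nat \<times> side) \<times> (nat \<times> side)) set" where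
  "edge_joins G =
     {((i, s), (k, t)) | i s k t.
        {i, k} \<in> edges G \<and> (if {i, k} \<in> twisted G then s = t else s \<noteq> t)}"

(* The joins form a 2-regular multigraph on the sides of the half-edges, so its cycles
   are its connected components. *)

definition faces :: "moebius_graph \<Rightarrow> (nat \<times> side) set set" where
  "faces G =
     (let R = vertex_joins G \<union> edge_joins G
      in ({1..sum_list (degrees G)} \<times> UNIV) // (R \<union> R\<inverse>)\<^sup>*)"

definition euler_char :: "moebius_graph \<Rightarrow> int" where
  "euler_char G = int (length (degrees G)) - int (card (edges G)) + int (card (faces G))"

(* "X i = X k" is equality of the chosen members of {Z 0, qcnj Z 0, Z 1, qcnj Z 1, ...};
   c i is the index with X i = Z (c i) or X i = qcnj Z (c i). *)

definition moebius_family ::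
    "nat list \<Rightarrow> (nat \<Rightarrow> nat) \<Rightarrow> (nat \<Rightarrow> 'a \<Rightarrow> quat) \<Rightarrow> moebius_graph set" where
  "moebius_family js c X =
     {G. is_moebius_graph G \<and> degrees G = js \<and>
         (\<forall>i k. {i, k} \<in> edges G \<longrightarrow>
            c i = c k \<and>
            (if {i, k} \<in> twisted G then X i = X k else X i = (\<lambda>\<omega>. qcnj (X k \<omega>))))}"

end

theory Submission
  imports Defs
begin

text \<open>
  Every \<open>X i\<close> is a combination of quaternion units, possibly conjugated, with Gaussian coefficients.
  Expanding the product of real parts multilinearly (\<open>multilinear_expand\<close>) leaves expectations of
  products of independent standard normal variables, and Wick's formula (\<open>quat_wick\<close>) counts
  these as pairings of the half-edges along which both the index \<open>c i\<close> and the chosen unit are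
  constant. Exchanging the two sums, each admissible pairing contributes a sum over labellings of
  its edges by quaternion units, and the theorem reduces to the claim that this sum is
  \<open>(-2) ^ (n - m + f)\<close>, where \<open>f\<close> is the number of faces of the Moebius graph of the pairing.

  The claim rests on an analogy: quaternions behave like real matrices of size \<open>-2\<close>. Put
  \<open>T q = - 2 * qRe q\<close>, so that \<open>T 1 = - 2\<close>. Summing over the four units \<open>e\<close>,
  \<open>\<Sum> T (e x e* y) = -2 T x T y\<close>, \<open>\<Sum> T (e x e y) = -2 T (x* y)\<close> and
  \<open>\<Sum> T (e x) T (e* y) = -2 T (x y)\<close>. Up to the factor \<open>-2\<close> these are the identities that matrix
  units satisfy with respect to the trace and the transpose. The locale \<open>gluing_trace\<close> captures both
  cases. In it the edges can be removed one after the other, and the whole sum comes out as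
  \<open>\<gamma> ^ n * N ^ f\<close> (\<open>sum_trace_product\<close>), where \<open>N\<close> is the trace of the unit and the exponent \<open>f\<close>
  depends only on the words being glued, not on the algebra.

  It remains to recognise \<open>f\<close>. For real matrices of size 2 the same sum counts the
  two-colourings of the sides of the ribbons that are constant along all joins, which are as many as
  \<open>2 ^ (number of faces)\<close>; hence \<open>f\<close> is the number of faces (\<open>gluing_faces\<close>). Since the exponent is the
  same for the quaternions, no signs have to be followed through the reduction.
\<close>

section \<open>Functions constant on the blocks of a partition\<close>

definition block_constant :: "'a set set \<Rightarrow> ('a \<Rightarrow> 'b) \<Rightarrow> bool" where
  "block_constant P a \<longleftrightarrow> (\<forall>p\<in>P. \<forall>i\<in>p. \<forall>k\<in>p. a i = a k)"

definition block_of :: "'a set set \<Rightarrow> 'a \<Rightarrow> 'a set" where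
  "block_of P i = (THE p. p \<in> P \<and> i \<in> p)"

lemma block_of_eq:
  assumes "partition_on S P" "p \<in> P" "i \<in> p"
  shows "block_of P i = p"
  unfolding block_of_def
  using assms by (intro the_equality) (auto simp: partition_on_def disjoint_def)

lemma block_of_mem:
  assumes "partition_on S P" "i \<in> S"
  shows "block_of P i \<in> P" "i \<in> block_of P i"
proof -
  obtain p where "p \<in> P" "i \<in> p" using assms by (auto simp: partition_on_def)
  with block_of_eq[OF assms(1)] show "block_of P i \<in> P" "i \<in> block_of P i" by auto
qed

text \<open>
  Labelling half-edges by a block-constant function is the same as labelling edges; the same bijection,
  applied to the partition into faces, counts colourings of sides.
\<close>

lemma bij_betw_block_constant:
  assumes "partition_on S P"
  shows "bij_betw (\<lambda>g. \<lambda>i\<in>S. g (block_of P i)) (P \<rightarrow>\<^sub>E I) {a \<in> S \<rightarrow>\<^sub>E I. block_constant P a}"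
proof (rule bij_betwI[where g = "\<lambda>a. \<lambda>p\<in>P. a (SOME i. i \<in> p)"])
  have some: "(SOME i. i \<in> p) \<in> p" if "p \<in> P" for p
    using assms that by (metis partition_on_def someI ex_in_conv)
  have sub: "p \<subseteq> S" if "p \<in> P" for p using assms that by (auto simp: partition_on_def)
  show "(\<lambda>g. \<lambda>i\<in>S. g (block_of P i)) \<in> (P \<rightarrow>\<^sub>E I) \<rightarrow> {a \<in> S \<rightarrow>\<^sub>E I. block_constant P a}"
    using block_of_mem[OF assms] block_of_eq[OF assms] sub
    by (auto simp: block_constant_def PiE_def Pi_def subset_iff)
  show "(\<lambda>a. \<lambda>p\<in>P. a (SOME i. i \<in> p)) \<in> {a \<in> S \<rightarrow>\<^sub>E I. block_constant P a} \<rightarrow> (P \<rightarrow>\<^sub>E I)"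
  proof
    fix a assume a: "a \<in> {a \<in> S \<rightarrow>\<^sub>E I. block_constant P a}"
    have "a (SOME i. i \<in> p) \<in> I" if "p \<in> P" for p
      using a some[OF that] sub[OF that] by (auto simp: PiE_def Pi_def)
    then show "(\<lambda>p\<in>P. a (SOME i. i \<in> p)) \<in> P \<rightarrow>\<^sub>E I" by simp
  qed
  show "(\<lambda>p\<in>P. (\<lambda>i\<in>S. g (block_of P i)) (SOME i. i \<in> p)) = g" if "g \<in> P \<rightarrow>\<^sub>E I" for g
  proof
    fix p
    show "(\<lambda>p\<in>P. (\<lambda>i\<in>S. g (block_of P i)) (SOME i. i \<in> p)) p = g p"
      using that some[of p] sub[of p] block_of_eq[OF assms, of p]
      by (cases "p \<in> P") (auto simp: PiE_def extensional_def)
  qed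
  show "(\<lambda>i\<in>S. (\<lambda>p\<in>P. a (SOME i. i \<in> p)) (block_of P i)) = a"
    if a: "a \<in> {a \<in> S \<rightarrow>\<^sub>E I. block_constant P a}" for a
  proof
    fix i
    show "(\<lambda>i\<in>S. (\<lambda>p\<in>P. a (SOME i. i \<in> p)) (block_of P i)) i = a i"
    proof (cases "i \<in> S")
      case True
      then have "a (SOME k. k \<in> block_of P i) = a i"
        using a block_of_mem[OF assms True] some unfolding block_constant_def by blast
      with True block_of_mem[OF assms True] show ?thesis by simp
    next
      case False
      with a show ?thesis by (auto simp: PiE_def extensional_def)
    qed
  qed
qed

section \<open>Gluing of signed words\<close>

text \<open>
  A word lists the letters met around one vertex. Each label is an edge of the graph and occurs twice in
  all words together; the sign of an occurrence says whether the generator attached to the label or its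
  adjoint stands there. Equal signs at the two occurrences mean a twisted edge, opposite signs an
  untwisted one.
\<close>

type_synonym 'l word = "('l \<times> bool) list"

text \<open>
  This is the word whose value is the adjoint of the value of \<open>w\<close>.
\<close>

definition inverse_word :: "'l word \<Rightarrow> 'l word" where
  "inverse_word w = rev (map (\<lambda>(l, b). (l, \<not> b)) w)"

definition word_labels :: "'l word list \<Rightarrow> 'l multiset" where
  "word_labels ws = image_mset fst (mset (concat ws))"

text \<open>
  \<open>gluing L ws f\<close> records one way to contract all edges in \<open>L\<close>: after contraction only empty words,
  that is isolated vertices, are left, and \<open>f\<close> is their number. Each contraction of an edge replaces the
  one or two vertices at its ends so that the faces of the ribbon graph survive: an untwisted loop splits
  its vertex in two, a twisted loop reverses one of the two arcs it cuts off, and an edge between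
  different vertices merges them, after reversal of one of them if the edge is twisted. An isolated
  vertex carries exactly one face, so \<open>f\<close> counts faces.
\<close>

inductive gluing :: "'l set \<Rightarrow> 'l word list \<Rightarrow> nat \<Rightarrow> bool" where
  empty: "gluing {} (replicate k []) k"
| cut: "gluing L (A # B # ws) f \<Longrightarrow> l \<notin> L \<Longrightarrow>
    gluing (insert l L) (((l, b) # A @ (l, \<not> b) # B) # ws) f"
| flip: "gluing L ((inverse_word A @ B) # ws) f \<Longrightarrow> l \<notin> L \<Longrightarrow>
    gluing (insert l L) (((l, b) # A @ (l, b) # B) # ws) f"
| merge: "gluing L ((A @ B) # ws) f \<Longrightarrow> l \<notin> L \<Longrightarrow>
    gluing (insert l L) (((l, b) # A) # ((l, \<not> b) # B) # ws) f"
| merge_flipped: "gluing L ((inverse_word A @ B) # ws) f \<Longrightarrow> l \<notin> L \<Longrightarrow>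
    gluing (insert l L) (((l, b) # A) # ((l, b) # B) # ws) f"
| rotate: "gluing L ((B @ A) # ws) f \<Longrightarrow> gluing L ((A @ B) # ws) f"
| permute: "gluing L ws f \<Longrightarrow> mset ws = mset ws' \<Longrightarrow> gluing L ws' f"

lemma labels_inverse_word [simp]: "image_mset fst (mset (inverse_word w)) = image_mset fst (mset w)"
  by (simp add: inverse_word_def image_mset.compositionality comp_def case_prod_unfold)

lemma word_labels_simps [simp]:
  "word_labels [] = {#}"
  "word_labels (w # ws) = image_mset fst (mset w) + word_labels ws"
  by (simp_all add: word_labels_def)

lemma word_labels_cong:
  assumes "mset ws = mset ws'"
  shows "word_labels ws = word_labels ws'"
proof -
  have "word_labels us = \<Sum>\<^sub># (image_mset (\<lambda>w. image_mset fst (mset w)) (mset us))" for us :: "'a word list"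
    by (induction us) auto
  with assms show ?thesis by simp
qed

lemma gluing_labels: "gluing L ws f \<Longrightarrow> finite L \<and> word_labels ws = mset_set L + mset_set L"
proof (induction rule: gluing.induct)
  case (empty k)
  then show ?case by (induction k) auto
next
  case (permute L ws f ws')
  then show ?case using word_labels_cong by metis
qed (auto simp: ac_simps)

text \<open>
  The contraction rules speak of a letter at the start of the first words; cyclic rotation and reordering
  bring any chosen letter there. The prefix \<open>vs\<close> protects words that are already in position, so that
  the lemma can be used for both occurrences of a label.
\<close>

lemma bring_label_to_front:
  assumes "l \<in># word_labels ws"
  shows "\<exists>b C us. word_labels (((l, b) # C) # us) = word_labels ws \<and>
    (\<forall>L vs f. gluing L (vs @ ((l, b) # C) # us) f \<longrightarrow> gluing L (vs @ ws) f)"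
proof -
  obtain w b where w: "w \<in> set ws" "(l, b) \<in> set w"
    using assms by (auto simp: word_labels_def)
  obtain us us' where ws: "ws = us @ w # us'" using w(1) by (meson split_list)
  obtain A B where wAB: "w = A @ (l, b) # B" using w(2) by (meson split_list)
  show ?thesis
  proof (intro exI conjI allI impI)
    show "word_labels (((l, b) # (B @ A)) # us @ us') = word_labels ws"
      by (simp add: ws wAB word_labels_def)
    fix L vs f
    assume "gluing L (vs @ ((l, b) # (B @ A)) # us @ us') f"
    then have "gluing L ((((l, b) # B) @ A) # vs @ us @ us') f"
      by (rule gluing.permute) simp
    then have "gluing L ((A @ ((l, b) # B)) # vs @ us @ us') f"
      by (rule gluing.rotate)
    then show "gluing L (vs @ ws) f"
      by (rule gluing.permute) (simp add: ws wAB)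
  qed
qed

text \<open>
  Contract the labels one at a time: whichever two positions a label occupies, exactly one of the four
  contraction rules applies, and what remains again contains every other label twice.
\<close>

lemma gluing_exists:
  assumes "finite L" "word_labels ws = mset_set L + mset_set L"
  shows "\<exists>f. gluing L ws f"
  using assms
proof (induction L arbitrary: ws rule: finite_induct)
  case empty
  then have "concat ws = []" by (simp add: word_labels_def)
  then have "\<forall>w\<in>set ws. w = []" by simp
  then obtain k where "ws = replicate k []" using replicate_length_same by metis
  then show ?case using gluing.empty[of k] by (intro exI[of _ k]) simp
next
  case (insert l L)
  have labels: "word_labels ws = add_mset l (add_mset l (mset_set L + mset_set L))"
    using insert by simp
  then have "l \<in># word_labels ws" by simp
  from bring_label_to_front[OF this] obtain b C us
    where 1: "word_labels (((l, b) # C) # us) = word_labels ws"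
    and g1: "\<forall>L vs f. gluing L (vs @ ((l, b) # C) # us) f \<longrightarrow> gluing L (vs @ ws) f"
    by (elim exE conjE) (rule that)
  have labels1: "word_labels (C # us) = add_mset l (mset_set L + mset_set L)"
    using 1[unfolded labels] by simp
  show ?case
  proof (cases "l \<in> fst ` set C")
    case True
    then obtain b' where "(l, b') \<in> set C" by auto
    then obtain A B where C: "C = A @ (l, b') # B" by (meson split_list)
    have lab: "word_labels (A # B # us) = mset_set L + mset_set L"
      using labels1 unfolding C by (simp add: ac_simps)
    have "\<exists>f. gluing (insert l L) (((l, b) # C) # us) f"
    proof (cases "b' = b")
      case True
      have "word_labels ((inverse_word A @ B) # us) = mset_set L + mset_set L"
        using lab by (simp add: ac_simps)
      then show ?thesis
        using insert.IH gluing.flip[OF _ insert.hyps(2)] unfolding C True by blast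
    next
      case False
      then have "b' = (\<not> b)" by simp
      then show ?thesis
        using insert.IH[OF lab] gluing.cut[OF _ insert.hyps(2)] unfolding C by blast
    qed
    then show ?thesis using g1[THEN spec, THEN spec, of "insert l L" "[]"] by auto
  next
    case False
    then have "l \<in># word_labels us"
      using labels1
      by (metis (no_types, lifting) add_mset_commute multi_member_split set_image_mset
        set_mset_mset union_iff union_single_eq_member word_labels_simps(2))
    from bring_label_to_front[OF this] obtain b' D vs
      where 2: "word_labels (((l, b') # D) # vs) = word_labels us"
      and g2: "\<forall>L xs f. gluing L (xs @ ((l, b') # D) # vs) f \<longrightarrow> gluing L (xs @ us) f"
      by (elim exE conjE) (rule that)
    have lab: "word_labels (C # D # vs) = mset_set L + mset_set L"
      using labels1 by (simp add: 2[symmetric] ac_simps)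
    have "\<exists>f. gluing (insert l L) (((l, b) # C) # ((l, b') # D) # vs) f"
    proof (cases "b' = b")
      case True
      have "word_labels ((inverse_word C @ D) # vs) = mset_set L + mset_set L"
        using lab by (simp add: ac_simps)
      then show ?thesis
        using insert.IH gluing.merge_flipped[OF _ insert.hyps(2)] unfolding True by blast
    next
      case False
      then have b': "b' = (\<not> b)" by simp
      have "word_labels ((C @ D) # vs) = mset_set L + mset_set L"
        using lab by (simp add: ac_simps)
      then show ?thesis
        using insert.IH gluing.merge[OF _ insert.hyps(2)] unfolding b' by blast
    qed
    then show ?thesis using g1[THEN spec, THEN spec, of "insert l L" "[]"]
        g2[THEN spec, THEN spec, of "insert l L" "[(l, b) # C]"] by auto
  qed
qed

section \<open>Traces adapted to gluing\<close>

lemma sum_PiE_insert: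
  fixes F :: "('l \<Rightarrow> 'i) \<Rightarrow> 'b :: comm_monoid_add"
  assumes "l \<notin> L"
  shows "sum F (insert l L \<rightarrow>\<^sub>E I) = (\<Sum>a\<in>L \<rightarrow>\<^sub>E I. \<Sum>i\<in>I. F (a(l := i)))"
proof -
  have inj: "inj_on (\<lambda>(y, g). g(l := y)) (I \<times> (L \<rightarrow>\<^sub>E I))"
    using assms by (intro inj_combinator)
  show ?thesis
    unfolding PiE_insert_eq sum.reindex[OF inj]
    by (subst sum.swap) (simp add: sum.cartesian_product case_prod_unfold comp_def)
qed


text \<open>
  The three identities \<open>tr_cut\<close>, \<open>tr_flip\<close> and \<open>tr_merge\<close> say what summing over the generator on one
  edge does to the vertices at its ends. Matrix units \<open>gen (s, t)\<close> with transpose and trace satisfy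
  them with \<open>\<gamma> = 1\<close>. The factor \<open>\<gamma>\<close> is there for the quaternions, where rescaling the four
  units to remove it would need the square root of a negative number.
\<close>

locale gluing_trace = monoid mult one
  for mult :: "'q \<Rightarrow> 'q \<Rightarrow> 'q" (infixl "\<cdot>" 70) and one :: 'q +
  fixes star :: "'q \<Rightarrow> 'q" and tr :: "'q \<Rightarrow> real"
    and I :: "'i set" and gen :: "'i \<Rightarrow> 'q" and \<gamma> :: real
  assumes finite_I: "finite I"
    and star_mult: "star (x \<cdot> y) = star y \<cdot> star x"
    and star_star [simp]: "star (star x) = x"
    and tr_star: "tr (star x) = tr x"
    and tr_commute: "tr (x \<cdot> y) = tr (y \<cdot> x)"
    and tr_cut: "(\<Sum>i\<in>I. tr (gen i \<cdot> x \<cdot> star (gen i) \<cdot> y)) = \<gamma> * (tr x * tr y)"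
    and tr_flip: "(\<Sum>i\<in>I. tr (gen i \<cdot> x \<cdot> gen i \<cdot> y)) = \<gamma> * tr (star x \<cdot> y)"
    and tr_merge: "(\<Sum>i\<in>I. tr (gen i \<cdot> x) * tr (star (gen i) \<cdot> y)) = \<gamma> * tr (x \<cdot> y)"
begin

lemma star_one [simp]: "star one = one"
  by (metis left_neutral right_neutral star_mult star_star)

definition signed_gen :: "'i \<Rightarrow> bool \<Rightarrow> 'q" where
  "signed_gen i b = (if b then gen i else star (gen i))"

definition word_value :: "('l \<Rightarrow> 'i) \<Rightarrow> 'l word \<Rightarrow> 'q" where
  "word_value a w = foldr (\<lambda>x. mult (signed_gen (a (fst x)) (snd x))) w one"

definition trace_product :: "('l \<Rightarrow> 'i) \<Rightarrow> 'l word list \<Rightarrow> real" where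
  "trace_product a ws = prod_list (map (\<lambda>w. tr (word_value a w)) ws)"

lemma star_signed_gen: "star (signed_gen i b) = signed_gen i (\<not> b)"
  by (simp add: signed_gen_def)

lemma word_value_simps [simp]:
  "word_value a [] = one"
  "word_value a ((l, b) # w) = signed_gen (a l) b \<cdot> word_value a w"
  by (simp_all add: word_value_def)

lemma word_value_append [simp]: "word_value a (v @ w) = word_value a v \<cdot> word_value a w"
  by (induction v) (auto simp: assoc)

lemma word_value_inverse [simp]: "word_value a (inverse_word w) = star (word_value a w)"
  by (induction w) (auto simp: inverse_word_def star_mult star_signed_gen)

lemma trace_product_simps [simp]:
  "trace_product a [] = 1"
  "trace_product a (w # ws) = tr (word_value a w) * trace_product a ws"
  by (simp_all add: trace_product_def)

lemma trace_product_permute: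
  assumes "mset ws = mset ws'"
  shows "trace_product a ws = trace_product a ws'"
proof -
  have "trace_product a us = prod_mset (image_mset (\<lambda>w. tr (word_value a w)) (mset us))"
    for us
    by (induction us) auto
  with assms show ?thesis by simp
qed

lemma word_value_cong: "(\<And>l. l \<in> fst ` set w \<Longrightarrow> a l = a' l) \<Longrightarrow> word_value a w = word_value a' w"
  by (induction w) auto

lemma sum_signed_cut:
  "(\<Sum>i\<in>I. tr (signed_gen i b \<cdot> x \<cdot> signed_gen i (\<not> b) \<cdot> y)) = \<gamma> * (tr x * tr y)"
proof (cases b)
  case True
  then show ?thesis using tr_cut by (simp add: signed_gen_def)
next
  case False
  have "tr (star (gen i) \<cdot> x \<cdot> gen i \<cdot> y) = tr (gen i \<cdot> y \<cdot> star (gen i) \<cdot> x)" for i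
    using tr_commute[of "star (gen i) \<cdot> x" "gen i \<cdot> y"] by (simp add: assoc)
  with False show ?thesis using tr_cut by (simp add: signed_gen_def mult.commute)
qed

lemma sum_signed_flip:
  "(\<Sum>i\<in>I. tr (signed_gen i b \<cdot> x \<cdot> signed_gen i b \<cdot> y)) = \<gamma> * tr (star x \<cdot> y)"
proof (cases b)
  case True
  then show ?thesis using tr_flip by (simp add: signed_gen_def)
next
  case False
  have "tr (star (gen i) \<cdot> x \<cdot> star (gen i) \<cdot> y) = tr (gen i \<cdot> star y \<cdot> gen i \<cdot> star x)" for i
  proof -
    have "tr (star (gen i) \<cdot> x \<cdot> star (gen i) \<cdot> y) = tr (star y \<cdot> (gen i \<cdot> star x \<cdot> gen i))"
      using tr_star[of "star (gen i) \<cdot> x \<cdot> star (gen i) \<cdot> y"] by (simp add: star_mult assoc)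
    also have "\<dots> = tr (gen i \<cdot> star x \<cdot> gen i \<cdot> star y)" by (rule tr_commute)
    also have "\<dots> = tr (gen i \<cdot> star y \<cdot> gen i \<cdot> star x)"
      using tr_commute[of "gen i \<cdot> star x" "gen i \<cdot> star y"] by (simp add: assoc)
    finally show ?thesis .
  qed
  moreover have "tr (y \<cdot> star x) = tr (star x \<cdot> y)" by (rule tr_commute)
  ultimately show ?thesis using False tr_flip[of "star y" "star x"] by (simp add: signed_gen_def)
qed

lemma sum_signed_merge:
  "(\<Sum>i\<in>I. tr (signed_gen i b \<cdot> x) * tr (signed_gen i (\<not> b) \<cdot> y)) = \<gamma> * tr (x \<cdot> y)"
  using tr_merge[of x y] tr_merge[of y x] tr_commute[of x y]
  by (cases b) (simp_all add: signed_gen_def mult.commute)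

lemma sum_signed_merge_flipped:
  "(\<Sum>i\<in>I. tr (signed_gen i b \<cdot> x) * tr (signed_gen i b \<cdot> y)) = \<gamma> * tr (star x \<cdot> y)"
proof -
  have "tr (signed_gen i b \<cdot> x) = tr (signed_gen i (\<not> b) \<cdot> star x)" for i
    using tr_star[of "signed_gen i b \<cdot> x"] tr_commute[of "star x"]
    by (simp add: star_mult star_signed_gen)
  then show ?thesis using sum_signed_merge[of "\<not> b" "star x" y] by simp
qed

lemma trace_product_update:
  assumes "l \<notin># word_labels ws"
  shows "trace_product (a(l := i)) ws = trace_product a ws"
proof -
  have "word_value (a(l := i)) w = word_value a w" if "w \<in> set ws" for w
    using assms that by (intro word_value_cong) (auto simp: word_labels_def)
  then show ?thesis unfolding trace_product_def by (metis (mono_tags, lifting) map_cong)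
qed

lemma word_value_update:
  assumes "l \<notin># word_labels (w # ws)"
  shows "word_value (a(l := i)) w = word_value a w"
  using assms by (intro word_value_cong) (auto simp: word_labels_def)

lemma gluing_new_label:
  assumes "gluing L ws f" "l \<notin> L"
  shows "l \<notin># word_labels ws"
  using gluing_labels[OF assms(1)] assms(2) by auto

text \<open>
  Each contraction rule matches one of the trace identities and costs one factor \<open>\<gamma>\<close>; each empty word
  left at the end contributes the trace of the unit. The right-hand side depends on the algebra only
  through \<open>\<gamma>\<close> and \<open>tr one\<close>, which is what makes it possible to compute \<open>f\<close> in one algebra and use it
  in another.
\<close>

theorem sum_trace_product:
  assumes "gluing L ws f"
  shows "(\<Sum>a\<in>L \<rightarrow>\<^sub>E I. trace_product a ws) = \<gamma> ^ card L * tr one ^ f"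
  using assms
proof (induction rule: gluing.induct)
  case (empty k)
  show ?case by (simp add: trace_product_def)
next
  case (cut L A B ws f l b)
  have new: "l \<notin># word_labels (A # B # ws)" using gluing_new_label[OF cut.hyps] by simp
  have fin: "finite L" using gluing_labels[OF cut.hyps(1)] by simp
  have [simp]: "word_value (a(l := i)) A = word_value a A" "word_value (a(l := i)) B = word_value a B"
    "trace_product (a(l := i)) ws = trace_product a ws" for a i
    using new by (auto intro!: word_value_update[of _ _ "[]"] trace_product_update)
  have "(\<Sum>i\<in>I. trace_product (a(l := i)) (((l, b) # A @ (l, \<not> b) # B) # ws)) =
      \<gamma> * trace_product a (A # B # ws)" for a
    using sum_signed_cut[of b "word_value a A" "word_value a B"]
    by (simp flip: sum_distrib_right add: assoc mult.assoc)
  then show ?case using cut fin by (simp add: sum_PiE_insert flip: sum_distrib_left del: trace_product_simps)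
next
  case (flip L A B ws f l b)
  have new: "l \<notin># word_labels (A # B # ws)" using gluing_new_label[OF flip.hyps] by simp
  have fin: "finite L" using gluing_labels[OF flip.hyps(1)] by simp
  have [simp]: "word_value (a(l := i)) A = word_value a A" "word_value (a(l := i)) B = word_value a B"
    "trace_product (a(l := i)) ws = trace_product a ws" for a i
    using new by (auto intro!: word_value_update[of _ _ "[]"] trace_product_update)
  have "(\<Sum>i\<in>I. trace_product (a(l := i)) (((l, b) # A @ (l, b) # B) # ws)) =
      \<gamma> * trace_product a ((inverse_word A @ B) # ws)" for a
    using sum_signed_flip[of b "word_value a A" "word_value a B"]
    by (simp flip: sum_distrib_right add: assoc mult.assoc)
  then show ?case using flip fin by (simp add: sum_PiE_insert flip: sum_distrib_left del: trace_product_simps)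
next
  case (merge L A B ws f l b)
  have new: "l \<notin># word_labels (A # B # ws)" using gluing_new_label[OF merge.hyps] by simp
  have fin: "finite L" using gluing_labels[OF merge.hyps(1)] by simp
  have [simp]: "word_value (a(l := i)) A = word_value a A" "word_value (a(l := i)) B = word_value a B"
    "trace_product (a(l := i)) ws = trace_product a ws" for a i
    using new by (auto intro!: word_value_update[of _ _ "[]"] trace_product_update)
  have "(\<Sum>i\<in>I. trace_product (a(l := i)) (((l, b) # A) # ((l, \<not> b) # B) # ws)) =
      \<gamma> * trace_product a ((A @ B) # ws)" for a
    using sum_signed_merge[of b "word_value a A" "word_value a B"]
    by (simp flip: sum_distrib_right mult.assoc)
  then show ?case using merge fin by (simp add: sum_PiE_insert flip: sum_distrib_left del: trace_product_simps)
next
  case (merge_flipped L A B ws f l b)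
  have new: "l \<notin># word_labels (A # B # ws)" using gluing_new_label[OF merge_flipped.hyps] by simp
  have fin: "finite L" using gluing_labels[OF merge_flipped.hyps(1)] by simp
  have [simp]: "word_value (a(l := i)) A = word_value a A" "word_value (a(l := i)) B = word_value a B"
    "trace_product (a(l := i)) ws = trace_product a ws" for a i
    using new by (auto intro!: word_value_update[of _ _ "[]"] trace_product_update)
  have "(\<Sum>i\<in>I. trace_product (a(l := i)) (((l, b) # A) # ((l, b) # B) # ws)) =
      \<gamma> * trace_product a ((inverse_word A @ B) # ws)" for a
    using sum_signed_merge_flipped[of b "word_value a A" "word_value a B"]
    by (simp flip: sum_distrib_right mult.assoc)
  then show ?case using merge_flipped fin by (simp add: sum_PiE_insert flip: sum_distrib_left del: trace_product_simps)
next
  case (rotate L B A ws f)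
  have "trace_product a ((A @ B) # ws) = trace_product a ((B @ A) # ws)" for a :: "'a \<Rightarrow> 'i"
    by (simp add: tr_commute)
  then show ?case using rotate.IH by (simp del: trace_product_simps word_value_append)
next
  case (permute L ws f ws')
  then show ?case by (simp add: trace_product_permute[OF permute(2)])
qed

lemma trace_product_relabel:
  "trace_product g (map (map (\<lambda>i. (\<phi> i, b i))) hs) =
   trace_product (\<lambda>i. g (\<phi> i)) (map (map (\<lambda>i. (i, b i))) hs)"
proof -
  have "word_value g (map (\<lambda>i. (\<phi> i, b i)) h) = word_value (\<lambda>i. g (\<phi> i)) (map (\<lambda>i. (i, b i)) h)" for h
    by (induction h) auto
  then show ?thesis by (simp add: trace_product_def comp_def)
qed

lemma trace_product_cong:
  assumes "\<And>l. l \<in># word_labels ws \<Longrightarrow> a l = a' l"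
  shows "trace_product a ws = trace_product a' ws"
proof -
  have "word_value a w = word_value a' w" if "w \<in> set ws" for w
    using assms that by (intro word_value_cong) (auto simp: word_labels_def)
  then show ?thesis unfolding trace_product_def by (simp cong: map_cong)
qed

lemma (in -) word_labels_map: "word_labels (map (map (\<lambda>i. (\<phi> i, b i))) hs) = image_mset \<phi> (mset (concat hs))"
  by (induction hs) (simp_all add: image_mset.compositionality comp_def)

text \<open>
  The same evaluation with generators attached to half-edges: a pairing turns them into labels by
  sending each half-edge to its edge.
\<close>

theorem sum_block_constant:
  assumes P: "partition_on S P"
    and hs: "set (concat hs) = S"
    and f: "gluing P (map (map (\<lambda>i. (block_of P i, b i))) hs) f"
  shows "(\<Sum>a | a \<in> S \<rightarrow>\<^sub>E I \<and> block_constant P a. trace_product a (map (map (\<lambda>i. (i, b i))) hs)) =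
    \<gamma> ^ card P * tr one ^ f"
proof -
  have "(\<Sum>a | a \<in> S \<rightarrow>\<^sub>E I \<and> block_constant P a. trace_product a (map (map (\<lambda>i. (i, b i))) hs)) =
      (\<Sum>g\<in>P \<rightarrow>\<^sub>E I. trace_product (\<lambda>i\<in>S. g (block_of P i)) (map (map (\<lambda>i. (i, b i))) hs))"
    by (rule sum.reindex_bij_betw[OF bij_betw_block_constant[OF P], symmetric])
  also have "\<dots> = (\<Sum>g\<in>P \<rightarrow>\<^sub>E I. trace_product g (map (map (\<lambda>i. (block_of P i, b i))) hs))"
    using hs
    by (intro sum.cong refl trans[OF trace_product_cong trace_product_relabel[symmetric]])
      (auto simp: word_labels_map)
  also have "\<dots> = \<gamma> ^ card P * tr one ^ f" using f by (rule sum_trace_product)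
  finally show ?thesis .
qed

end

text \<open>
  Every edge of a pairing contains exactly two half-edges, so its label occurs exactly twice.
\<close>

lemma gluing_pairing_exists:
  assumes P: "partition_on S P" "finite S" "\<And>p. p \<in> P \<Longrightarrow> card p = 2"
    and hs: "distinct (concat hs)" "set (concat hs) = S"
  shows "\<exists>f. gluing P (map (map (\<lambda>i. (block_of P i, b i))) hs) f"
proof (rule gluing_exists)
  show "finite P" by (rule finite_elements[OF P(2,1)])
  have "mset (concat hs) = mset_set S" using mset_set_set[OF hs(1)] hs(2) by simp
  moreover have "image_mset (block_of P) (mset_set S) = mset_set P + mset_set P"
  proof (rule multiset_eqI)
    fix p
    have "{i \<in> S. block_of P i = p} = (if p \<in> P then p else {})"
      using block_of_mem[OF P(1)] block_of_eq[OF P(1)] P(1) by (auto simp: partition_on_def)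
    then show "count (image_mset (block_of P) (mset_set S)) p = count (mset_set P + mset_set P) p"
      using P \<open>finite P\<close> by (simp add: count_image_mset_eq_card_vimage)
  qed
  ultimately show "word_labels (map (map (\<lambda>i. (block_of P i, b i))) hs) = mset_set P + mset_set P"
    by (simp add: word_labels_map)
qed

section \<open>The two algebras: quaternions and matrices of size 2\<close>

lemma sum_Basis_quat:
  "(\<Sum>e\<in>Basis. F (e :: quat)) = F (Quat 1 0 0 0) + F (Quat 0 1 0 0) + F (Quat 0 0 1 0) + F (Quat 0 0 0 1)"
  for F :: "quat \<Rightarrow> 'b::comm_monoid_add"
  by (simp add: Basis_quat_def add.assoc)

text \<open>
  The normalisation \<open>- 2 * qRe q\<close> of the trace is forced: the sum over the units of \<open>qRe (e x e* y)\<close> is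
  \<open>4 * qRe x * qRe y\<close>, that of \<open>qRe (e x e y)\<close> is \<open>- 2 * qRe (x* y)\<close>, and only this multiple of \<open>qRe\<close>
  makes the three constants agree.
\<close>

interpretation quat: gluing_trace "(*)" "1 :: quat" qcnj "\<lambda>q. - 2 * qRe q" Basis "\<lambda>e. e" "- 2"
  by standard (simp_all add: quat_eq_iff sum_Basis_quat algebra_simps)

text \<open>
  Size 2 is chosen because rows and columns can then be indexed by truth values, so that matrix entries
  are indexed by colours of two sides; any size above 1 would separate different exponents \<open>f\<close>.
\<close>

definition mat_mult :: "(bool \<Rightarrow> bool \<Rightarrow> real) \<Rightarrow> (bool \<Rightarrow> bool \<Rightarrow> real) \<Rightarrow> bool \<Rightarrow> bool \<Rightarrow> real" where
  "mat_mult A B = (\<lambda>s t. \<Sum>u\<in>UNIV. A s u * B u t)"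

definition mat_one :: "bool \<Rightarrow> bool \<Rightarrow> real" where
  "mat_one = (\<lambda>s t. of_bool (s = t))"

definition mat_unit :: "bool \<times> bool \<Rightarrow> bool \<Rightarrow> bool \<Rightarrow> real" where
  "mat_unit x = (\<lambda>s t. of_bool (s = fst x \<and> t = snd x))"

definition mat_trace :: "(bool \<Rightarrow> bool \<Rightarrow> real) \<Rightarrow> real" where
  "mat_trace A = (\<Sum>s\<in>UNIV. A s s)"

lemma sum_UNIV_bool_times: "(\<Sum>x\<in>UNIV. F (x :: bool \<times> bool)) = (\<Sum>s\<in>UNIV. \<Sum>t\<in>UNIV. F (s, t))"
  for F :: "bool \<times> bool \<Rightarrow> real"
  by (simp add: sum.cartesian_product flip: UNIV_Times_UNIV)

lemma mat_eq_iff: "A = B \<longleftrightarrow> (\<forall>s t. A s t = B s t)" for A B :: "bool \<Rightarrow> bool \<Rightarrow> real"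
  by (simp add: fun_eq_iff)

interpretation mat: gluing_trace mat_mult mat_one "\<lambda>A s t. A t s" mat_trace UNIV mat_unit 1
  by standard
    (simp_all add: mat_eq_iff all_bool_eq mat_mult_def mat_one_def mat_unit_def mat_trace_def
      sum_UNIV_bool_times UNIV_bool algebra_simps)

lemma mat_trace_one: "mat_trace mat_one = 2"
  by (simp add: mat_trace_def mat_one_def)

text \<open>
  The matrix unit attached to a label colours the two sides of the corresponding ribbon; the sign of an
  occurrence decides which side a walk around the vertex meets first.
\<close>

definition letter_source :: "('l \<Rightarrow> bool \<times> bool) \<Rightarrow> 'l \<times> bool \<Rightarrow> bool" where
  "letter_source a x = (if snd x then fst (a (fst x)) else snd (a (fst x)))"

definition letter_target :: "('l \<Rightarrow> bool \<times> bool) \<Rightarrow> 'l \<times> bool \<Rightarrow> bool" where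
  "letter_target a x = (if snd x then snd (a (fst x)) else fst (a (fst x)))"

lemma mat_signed_gen:
  "mat.signed_gen (a l) b = (\<lambda>s t. of_bool (s = letter_source a (l, b) \<and> t = letter_target a (l, b)))"
  by (auto simp: fun_eq_iff mat.signed_gen_def mat_unit_def letter_source_def letter_target_def)

lemma mat_word_value:
  assumes "w \<noteq> []"
  shows "mat.word_value a w = (\<lambda>s t. of_bool (s = letter_source a (hd w) \<and> t = letter_target a (last w) \<and>
    (\<forall>p. Suc p < length w \<longrightarrow> letter_target a (w ! p) = letter_source a (w ! Suc p))))"
  using assms
proof (induction w rule: list_nonempty_induct)
  case (single x)
  show ?case by (cases x) (simp add: mat_signed_gen mat.right_neutral)
next
  case (cons x w)
  obtain l b where x: "x = (l, b)" by (cases x)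
  have chain: "(\<forall>p. Suc p < length (x # w) \<longrightarrow> letter_target a ((x # w) ! p) = letter_source a ((x # w) ! Suc p)) \<longleftrightarrow>
      letter_target a x = letter_source a (hd w) \<and>
      (\<forall>p. Suc p < length w \<longrightarrow> letter_target a (w ! p) = letter_source a (w ! Suc p))"
    (is "?lhs \<longleftrightarrow> ?rhs")
  proof
    assume l: ?lhs
    show ?rhs using l[rule_format, of 0] l[rule_format, of "Suc _"] cons.hyps by (auto simp: hd_conv_nth)
  next
    assume r: ?rhs
    show ?lhs
    proof (intro allI impI)
      fix p assume "Suc p < length (x # w)"
      then show "letter_target a ((x # w) ! p) = letter_source a ((x # w) ! Suc p)"
        using r cons.hyps by (cases p) (auto simp: hd_conv_nth)
    qed
  qed
  have "mat.word_value a (x # w) =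
      mat_mult (\<lambda>s t. of_bool (s = letter_source a x \<and> t = letter_target a x)) (mat.word_value a w)"
    unfolding x mat.word_value_simps mat_signed_gen ..
  then show ?case
    unfolding chain cons.IH mat_mult_def using cons.hyps by (auto simp: fun_eq_iff UNIV_bool)
qed

text \<open>
  A product of matrix units is nonzero only if consecutive indices match, and its trace also closes the
  cycle. So the trace of a word tests whether the colours agree along all joins at the vertex.
\<close>

lemma mat_trace_word:
  assumes "w \<noteq> []"
  shows "mat_trace (mat.word_value a w) =
    of_bool (\<forall>p<length w. letter_target a (w ! p) = letter_source a (w ! (Suc p mod length w)))"
proof -
  have "(\<forall>p<length w. letter_target a (w ! p) = letter_source a (w ! (Suc p mod length w))) \<longleftrightarrow>
      letter_target a (last w) = letter_source a (hd w) \<and>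
      (\<forall>p. Suc p < length w \<longrightarrow> letter_target a (w ! p) = letter_source a (w ! Suc p))"
    (is "?lhs \<longleftrightarrow> ?rhs")
  proof
    assume l: ?lhs
    show ?rhs
      using l[rule_format, of "length w - 1"] l assms
      by (auto simp: hd_conv_nth last_conv_nth)
  next
    assume r: ?rhs
    show ?lhs
    proof (intro allI impI)
      fix p assume "p < length w"
      then consider "Suc p < length w" | "Suc p = length w" by linarith
      then show "letter_target a (w ! p) = letter_source a (w ! (Suc p mod length w))"
      proof cases
        case 2
        then have "p = length w - 1" by simp
        with 2 r assms show ?thesis by (simp add: hd_conv_nth last_conv_nth)
      qed (use r in simp)
    qed
  qed
  then show ?thesis
    unfolding mat_word_value[OF assms] mat_trace_def by (auto simp: UNIV_bool)
qed

section \<open>Faces as two-colourings of sides\<close>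

text \<open>
  A colouring respecting the joins is an arbitrary choice of one colour for every connected component.
\<close>

lemma card_two_colourings:
  assumes "finite A" "R \<subseteq> A \<times> A"
  shows "card {\<sigma> \<in> A \<rightarrow>\<^sub>E (UNIV :: bool set). \<forall>(x, y)\<in>R. \<sigma> x = \<sigma> y} = 2 ^ card (A // (R \<union> R\<inverse>)\<^sup>*)"
proof -
  define E where "E = (R \<union> R\<inverse>)\<^sup>*"
  \<comment> \<open>Points outside \<open>A\<close> are isolated, so \<open>E\<close> is an equivalence on the whole type and its classes of points of \<open>A\<close> partition \<open>A\<close>.\<close>
  have E: "equiv UNIV E"
    unfolding E_def by (intro equivI sym_rtrancl sym_Un_converse refl_rtrancl trans_rtrancl) auto
  have closed: "y \<in> A" if "(x, y) \<in> E" "x \<in> A" for x y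
    using that unfolding E_def by (induction rule: rtrancl_induct) (use assms(2) in auto)
  have part: "partition_on A (A // E)"
  proof (rule partition_onI)
    show "\<Union>(A // E) = A"
      using closed E by (auto simp: quotient_def equiv_def refl_on_def)
    show "{} \<notin> A // E"
      using E by (auto simp: quotient_def equiv_def refl_on_def)
    show "disjnt p q" if "p \<in> A // E" "q \<in> A // E" "p \<noteq> q" for p q
    proof -
      have "p \<in> UNIV // E" "q \<in> UNIV // E" using that by (auto simp: quotient_def)
      with that show ?thesis using quotient_disj[OF E] by (auto simp: disjnt_def)
    qed
  qed
  have fin: "finite (A // E)" by (rule finite_elements[OF assms(1) part])
  have "(\<forall>(x, y)\<in>R. \<sigma> x = \<sigma> y) \<longleftrightarrow> block_constant (A // E) \<sigma>" for \<sigma> :: "'a \<Rightarrow> bool"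
  proof
    assume R: "\<forall>(x, y)\<in>R. \<sigma> x = \<sigma> y"
    have "\<sigma> x = \<sigma> y" if "(x, y) \<in> E" for x y
      using that unfolding E_def by (induction rule: rtrancl_induct) (use R in auto)
    then show "block_constant (A // E) \<sigma>"
      unfolding block_constant_def quotient_def by (clarsimp simp: Image_singleton_iff) metis
  next
    assume bc: "block_constant (A // E) \<sigma>"
    show "\<forall>(x, y)\<in>R. \<sigma> x = \<sigma> y"
    proof clarify
      fix x y assume "(x, y) \<in> R"
      then have "x \<in> A" "(x, y) \<in> E" using assms(2) by (auto simp: E_def)
      moreover have "(x, x) \<in> E" by (simp add: E_def)
      ultimately show "\<sigma> x = \<sigma> y"
        using bc unfolding block_constant_def by (meson Image_singleton_iff quotientI)
    qed
  qed
  then have "card {\<sigma> \<in> A \<rightarrow>\<^sub>E (UNIV :: bool set). \<forall>(x, y)\<in>R. \<sigma> x = \<sigma> y} = card ((A // E) \<rightarrow>\<^sub>E (UNIV :: bool set))"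
    using bij_betw_same_card[OF bij_betw_block_constant[OF part, of "UNIV :: bool set"]] by simp
  then show ?thesis using fin by (simp add: card_PiE E_def)
qed

lemma concat_half_edges:
  "r \<le> length ds \<Longrightarrow> concat (map (half_edges ds) [0..<r]) = [1..<sum_list (take r ds) + 1]"
proof (induction r)
  case (Suc r)
  have "sum_list (take (Suc r) ds) = sum_list (take r ds) + ds ! r"
    using Suc.prems by (simp add: take_Suc_conv_app_nth)
  moreover have "[1..<(sum_list (take r ds) + 1) + ds ! r] =
      [1..<sum_list (take r ds) + 1] @ [sum_list (take r ds) + 1..<(sum_list (take r ds) + 1) + ds ! r]"
    by (rule upt_add_eq_append) simp
  ultimately show ?case using Suc by (simp add: half_edges_def add_ac)
qed simp

definition vertex_words :: "nat list \<Rightarrow> nat list list" where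
  "vertex_words ds = map (half_edges ds) [0..<length ds]"

lemma concat_vertex_words: "concat (vertex_words ds) = [1..<sum_list ds + 1]"
  unfolding vertex_words_def by (subst concat_half_edges) simp_all

lemma half_edges_nonempty:
  assumes "\<forall>d\<in>set ds. 0 < d" "r < length ds"
  shows "half_edges ds r \<noteq> []" "set (half_edges ds r) \<subseteq> {1..sum_list ds}"
proof -
  show "half_edges ds r \<noteq> []"
    using assms nth_mem[OF assms(2)] by (auto simp: half_edges_def take_Suc_conv_app_nth Suc_le_eq)
  have "set (half_edges ds r) \<subseteq> set (concat (vertex_words ds))"
    using assms(2) by (auto simp: vertex_words_def)
  then show "set (half_edges ds r) \<subseteq> {1..sum_list ds}" unfolding concat_vertex_words by auto
qed

text \<open>
  With a positive sign the right side of the half-edge gets the first (row) index of the matrix unit and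
  the left side the second; a negative sign exchanges them, as the transpose does.
\<close>

definition side_colour :: "(nat \<Rightarrow> bool) \<Rightarrow> (nat \<Rightarrow> bool \<times> bool) \<Rightarrow> nat \<times> side \<Rightarrow> bool" where
  "side_colour b a x = (if (snd x = RightSide) = b (fst x) then fst (a (fst x)) else snd (a (fst x)))"

lemma bij_betw_side_colour:
  "bij_betw (\<lambda>a. restrict (side_colour b a) (S \<times> UNIV)) (S \<rightarrow>\<^sub>E UNIV) (S \<times> UNIV \<rightarrow>\<^sub>E UNIV)"
proof (rule bij_betwI[where g = "\<lambda>\<sigma>. \<lambda>i\<in>S. (\<sigma> (i, if b i then RightSide else LeftSide), \<sigma> (i, if b i then LeftSide else RightSide))"])
  fix a :: "nat \<Rightarrow> bool \<times> bool" assume "a \<in> S \<rightarrow>\<^sub>E UNIV"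
  then show "(\<lambda>i\<in>S. (restrict (side_colour b a) (S \<times> UNIV) (i, if b i then RightSide else LeftSide),
      restrict (side_colour b a) (S \<times> UNIV) (i, if b i then LeftSide else RightSide))) = a"
    by (auto simp: fun_eq_iff side_colour_def PiE_def extensional_def prod_eq_iff)
next
  fix \<sigma> :: "nat \<times> side \<Rightarrow> bool" assume \<sigma>: "\<sigma> \<in> S \<times> UNIV \<rightarrow>\<^sub>E UNIV"
  show "restrict (side_colour b (\<lambda>i\<in>S. (\<sigma> (i, if b i then RightSide else LeftSide),
      \<sigma> (i, if b i then LeftSide else RightSide)))) (S \<times> UNIV) = \<sigma>"
  proof
    fix x :: "nat \<times> side"
    obtain i s where "x = (i, s)" by force
    then show "restrict (side_colour b (\<lambda>i\<in>S. (\<sigma> (i, if b i then RightSide else LeftSide),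
      \<sigma> (i, if b i then LeftSide else RightSide)))) (S \<times> UNIV) x = \<sigma> x"
      using \<sigma> by (cases s; cases "b i") (auto simp: side_colour_def PiE_def extensional_def)
  qed
qed (auto)

text \<open>
  Because an edge is twisted exactly if its two signs agree, sides joined along the edge always carry the
  same index of the matrix units at the two ends.
\<close>

lemma edge_joins_colour:
  assumes tw: "\<And>i k. {i, k} \<in> edges G \<Longrightarrow> {i, k} \<in> twisted G \<longleftrightarrow> b i = b k"
    and two: "\<And>e. e \<in> edges G \<Longrightarrow> card e = 2"
  shows "(\<forall>(x, y)\<in>edge_joins G. side_colour b a x = side_colour b a y) \<longleftrightarrow> block_constant (edges G) a"
proof
  assume bc: "block_constant (edges G) a"
  show "\<forall>(x, y)\<in>edge_joins G. side_colour b a x = side_colour b a y"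
  proof clarify
    fix i s k t assume "((i, s), (k, t)) \<in> edge_joins G"
    then have e: "{i, k} \<in> edges G" and st: "if b i = b k then s = t else s \<noteq> t"
      using tw by (auto simp: edge_joins_def)
    then have "a i = a k" using bc by (auto simp: block_constant_def)
    with st show "side_colour b a (i, s) = side_colour b a (k, t)"
      by (cases s; cases t; cases "b i"; cases "b k") (auto simp: side_colour_def)
  qed
next
  assume L: "\<forall>(x, y)\<in>edge_joins G. side_colour b a x = side_colour b a y"
  show "block_constant (edges G) a"
    unfolding block_constant_def
  proof (intro ballI)
    fix e i k assume e: "e \<in> edges G" "i \<in> e" "k \<in> e"
    show "a i = a k"
    proof (cases "i = k")
      case False
      have "{i, k} = e"
        using two[OF e(1)] e False by (auto simp: card_2_iff)
      with e have ik: "{i, k} \<in> edges G" by simp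
      have join: "((i, s), (k, t)) \<in> edge_joins G" if "if b i = b k then s = t else s \<noteq> t" for s t
        using ik that tw[OF ik] by (auto simp: edge_joins_def)
      have colour: "side_colour b a (i, s) = side_colour b a (k, t)"
        if "if b i = b k then s = t else s \<noteq> t" for s t
        using L join[OF that] by blast
      show ?thesis
        using colour[of LeftSide LeftSide] colour[of RightSide RightSide]
          colour[of LeftSide RightSide] colour[of RightSide LeftSide]
        by (cases "b i"; cases "b k") (auto simp: side_colour_def prod_eq_iff)
    qed simp
  qed
qed

lemma prod_list_of_bool: "(\<Prod>x\<leftarrow>xs. of_bool (Q x) :: real) = of_bool (\<forall>x\<in>set xs. Q x)"
  by (induction xs) auto

lemma mat_trace_product_vertex_words:
  assumes "\<forall>d\<in>set (degrees G). 0 < d"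
  shows "mat.trace_product a (map (map (\<lambda>i. (i, b i))) (vertex_words (degrees G))) =
    of_bool (\<forall>(x, y)\<in>vertex_joins G. side_colour b a x = side_colour b a y)"
proof -
  define ds where "ds = degrees G"
  define ok where "ok r \<longleftrightarrow> (\<forall>p<length (half_edges ds r). side_colour b a (half_edges ds r ! p, LeftSide) =
      side_colour b a (half_edges ds r ! (Suc p mod length (half_edges ds r)), RightSide))" for r
  have src: "letter_source a (i, b i) = side_colour b a (i, RightSide)"
    and tgt: "letter_target a (i, b i) = side_colour b a (i, LeftSide)" for i
    by (auto simp: letter_source_def letter_target_def side_colour_def)
  have tr: "mat_trace (mat.word_value a (map (\<lambda>i. (i, b i)) (half_edges ds r))) = of_bool (ok r)"
    if "r < length ds" for r
  proof -
    let ?h = "half_edges ds r"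
    have ne: "?h \<noteq> []" using half_edges_nonempty(1)[OF assms, folded ds_def] that by blast
    have "Suc p mod length ?h < length ?h" for p using ne by simp
    with ne show ?thesis by (subst mat_trace_word) (auto simp: ok_def src tgt)
  qed
  have "mat.trace_product a (map (map (\<lambda>i. (i, b i))) (vertex_words ds)) =
      prod_list (map (\<lambda>r. of_bool (ok r)) [0..<length ds])"
    unfolding mat.trace_product_def vertex_words_def
    by (auto simp: comp_def tr intro!: arg_cong[of _ _ prod_list])
  also have "\<dots> = of_bool (\<forall>r\<in>set [0..<length ds]. ok r)"
    by (rule prod_list_of_bool)
  also have "(\<forall>r\<in>set [0..<length ds]. ok r) \<longleftrightarrow> (\<forall>(x, y)\<in>vertex_joins G. side_colour b a x = side_colour b a y)"
    unfolding vertex_joins_def ok_def ds_def by fastforce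
  finally show ?thesis unfolding ds_def .
qed

lemma joins_subset:
  assumes "is_moebius_graph G"
  shows "vertex_joins G \<union> edge_joins G \<subseteq> ({1..sum_list (degrees G)} \<times> UNIV) \<times> ({1..sum_list (degrees G)} \<times> UNIV)"
proof -
  let ?ds = "degrees G"
  have pos: "\<forall>d\<in>set ?ds. 0 < d" and part: "partition_on {1..sum_list ?ds} (edges G)"
    using assms by (auto simp: is_moebius_graph_def)
  have "h ! p \<in> {1..sum_list ?ds} \<and> h ! (Suc p mod length h) \<in> {1..sum_list ?ds}"
    if "r < length ?ds" "h = half_edges ?ds r" "p < length h" for h r p
  proof -
    have "h ! p \<in> set h" "h ! (Suc p mod length h) \<in> set h"
      using that by (auto intro!: nth_mem mod_less_divisor)
    then show ?thesis using half_edges_nonempty(2)[OF pos that(1)] that by blast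
  qed
  moreover have "i \<in> {1..sum_list ?ds} \<and> k \<in> {1..sum_list ?ds}" if "{i, k} \<in> edges G" for i k
    using part that by (auto simp: partition_on_def)
  ultimately show ?thesis unfolding vertex_joins_def edge_joins_def by blast
qed

text \<open>
  Both sides of \<open>2 ^ f = 2 ^ card (faces G)\<close> count the colourings of the sides that are constant along
  all joins: the left one by contraction in the matrix algebra, the right one directly.
\<close>

theorem gluing_faces:
  assumes G: "is_moebius_graph G"
    and tw: "\<And>i k. {i, k} \<in> edges G \<Longrightarrow> {i, k} \<in> twisted G \<longleftrightarrow> b i = b k"
    and f: "gluing (edges G) (map (map (\<lambda>i. (block_of (edges G) i, b i))) (vertex_words (degrees G))) f"
  shows "f = card (faces G)"
proof -
  let ?ds = "degrees G" and ?S = "{1..sum_list (degrees G)}"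
  let ?J = "vertex_joins G \<union> edge_joins G"
  let ?C = "{\<sigma> \<in> ?S \<times> UNIV \<rightarrow>\<^sub>E (UNIV :: bool set). \<forall>(x, y)\<in>?J. \<sigma> x = \<sigma> y}"
  let ?B = "{a. (a \<in> ?S \<rightarrow>\<^sub>E (UNIV :: (bool \<times> bool) set) \<and> block_constant (edges G) a) \<and>
    (\<forall>(x, y)\<in>vertex_joins G. side_colour b a x = side_colour b a y)}"
  have pos: "\<forall>d\<in>set ?ds. 0 < d" and part: "partition_on ?S (edges G)"
    and two: "\<And>e. e \<in> edges G \<Longrightarrow> card e = 2"
    using G by (auto simp: is_moebius_graph_def)
  have fin: "finite (?S \<times> (UNIV :: side set))"
  proof -
    have "(UNIV :: side set) = {LeftSide, RightSide}" using side.exhaust by auto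
    then show ?thesis by (metis finite.intros finite_SigmaI finite_atLeastAtMost)
  qed
  have finA: "finite {a. a \<in> ?S \<rightarrow>\<^sub>E (UNIV :: (bool \<times> bool) set) \<and> block_constant (edges G) a}"
    by (rule finite_subset[of _ "?S \<rightarrow>\<^sub>E UNIV"]) (auto intro: finite_PiE)
  \<comment> \<open>Since the matrix algebra has \<open>\<gamma> = 1\<close>, its contraction formula is a pure power of 2.\<close>
  have "(2::real) ^ f = mat_trace mat_one ^ f" by (simp add: mat_trace_one)
  also have "\<dots> = (\<Sum>a | a \<in> ?S \<rightarrow>\<^sub>E UNIV \<and> block_constant (edges G) a.
      mat.trace_product a (map (map (\<lambda>i. (i, b i))) (vertex_words ?ds)))"
    by (subst mat.sum_block_constant[OF part _ f]) (auto simp: concat_vertex_words)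
  also have "\<dots> = real (card ?B)"
    unfolding mat_trace_product_vertex_words[OF pos] using finA
    by (simp add: sum_of_bool_eq Int_def)
  also have "card ?B = card ?C"
  proof -
    have iff: "(\<forall>(x, y)\<in>?J. restrict (side_colour b a) (?S \<times> UNIV) x = restrict (side_colour b a) (?S \<times> UNIV) y) \<longleftrightarrow>
        block_constant (edges G) a \<and> (\<forall>(x, y)\<in>vertex_joins G. side_colour b a x = side_colour b a y)" for a
    proof -
      have "(\<forall>(x, y)\<in>?J. restrict (side_colour b a) (?S \<times> UNIV) x = restrict (side_colour b a) (?S \<times> UNIV) y) \<longleftrightarrow>
        (\<forall>(x, y)\<in>?J. side_colour b a x = side_colour b a y)"
        using joins_subset[OF G] by (intro ball_cong refl) auto
      then show ?thesis using edge_joins_colour[of G b a, OF tw two] by auto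
    qed
    have "bij_betw (\<lambda>a. restrict (side_colour b a) (?S \<times> UNIV)) ?B ?C"
      using bij_betw_Collect[OF bij_betw_side_colour, of ?S "\<lambda>\<sigma>. \<forall>(x, y)\<in>?J. \<sigma> x = \<sigma> y" b
          "\<lambda>a. block_constant (edges G) a \<and> (\<forall>(x, y)\<in>vertex_joins G. side_colour b a x = side_colour b a y)"] iff
      by (simp add: conj_assoc)
    then show ?thesis by (rule bij_betw_same_card)
  qed
  also have "card ?C = 2 ^ card (faces G)"
    unfolding faces_def Let_def by (rule card_two_colourings[OF fin joins_subset[OF G]])
  finally have "(2::real) ^ f = 2 ^ card (faces G)" by simp
  then show ?thesis by simp
qed

text \<open>
  The contribution of one pairing. The exponent found by contraction is known from the matrix algebra, so
  the quaternion sum is \<open>\<gamma> ^ n * N ^ f\<close> with both \<open>\<gamma>\<close> and \<open>N\<close> equal to \<open>-2\<close>.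
\<close>

theorem sum_pairing_quat:
  assumes G: "is_moebius_graph G"
    and tw: "\<And>i k. {i, k} \<in> edges G \<Longrightarrow> {i, k} \<in> twisted G \<longleftrightarrow> b i = b k"
  shows "(\<Sum>a | a \<in> {1..sum_list (degrees G)} \<rightarrow>\<^sub>E Basis \<and> block_constant (edges G) a.
      \<Prod>h\<leftarrow>vertex_words (degrees G). - 2 * qRe (\<Prod>i\<leftarrow>h. if b i then a i else qcnj (a i))) =
    (- 2) ^ (card (edges G) + card (faces G))"
proof -
  have part: "partition_on {1..sum_list (degrees G)} (edges G)"
    and two: "\<And>e. e \<in> edges G \<Longrightarrow> card e = 2"
    using G by (auto simp: is_moebius_graph_def)
  have dist: "distinct (concat (vertex_words (degrees G)))"
    and set: "set (concat (vertex_words (degrees G))) = {1..sum_list (degrees G)}"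
    by (auto simp: concat_vertex_words)
  obtain f where f: "gluing (edges G) (map (map (\<lambda>i. (block_of (edges G) i, b i))) (vertex_words (degrees G))) f"
    using gluing_pairing_exists[OF part _ two dist set] by auto
  have word: "quat.word_value a (map (\<lambda>i. (i, b i)) h) = (\<Prod>i\<leftarrow>h. if b i then a i else qcnj (a i))" for a :: "nat \<Rightarrow> quat" and h
    by (induction h) (auto simp: quat.signed_gen_def)
  have "quat.trace_product a (map (map (\<lambda>i. (i, b i))) hs) =
      (\<Prod>h\<leftarrow>hs. - 2 * qRe (\<Prod>i\<leftarrow>h. if b i then a i else qcnj (a i)))" for a :: "nat \<Rightarrow> quat" and hs
    unfolding quat.trace_product_def word by (simp add: comp_def word)
  then show ?thesis
    using quat.sum_block_constant[OF part set f] gluing_faces[OF G tw f]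
    by (simp add: power_add)
qed

section \<open>Pairings and Wick's formula\<close>

definition pairings :: "'a set \<Rightarrow> 'a set set set" where
  "pairings S = {P. partition_on S P \<and> (\<forall>p\<in>P. card p = 2)}"

lemma finite_pairings: "finite S \<Longrightarrow> finite (pairings S)"
  by (rule finite_subset[of _ "Pow (Pow S)"]) (auto simp: pairings_def partition_on_def)

lemma block_constant_insert_pair:
  "block_constant (insert {i, k} P) u \<longleftrightarrow> u i = u k \<and> block_constant P u"
  by (auto simp: block_constant_def)

text \<open>
  Condition on the partner \<open>k\<close> of a fixed element \<open>i\<close>.
\<close>

lemma card_pairings_rec:
  fixes u :: "'a \<Rightarrow> 'u"
  assumes "finite S" "i \<in> S"
  shows "card {P \<in> pairings S. block_constant P u} =
    (\<Sum>k | k \<in> S - {i} \<and> u k = u i. card {P \<in> pairings (S - {i, k}). block_constant P u})"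
proof -
  let ?K = "{k. k \<in> S - {i} \<and> u k = u i}"
  let ?C = "\<lambda>k. {P \<in> pairings (S - {i, k}). block_constant P u}"
  let ?f = "\<lambda>(k, P). insert {i, k} P"
  have notin: "\<forall>p\<in>P. i \<notin> p" if "P \<in> ?C k" for P k
    using that by (auto simp: pairings_def partition_on_def)
  have "bij_betw ?f (Sigma ?K ?C) {P \<in> pairings S. block_constant P u}"
    unfolding bij_betw_def
  proof
    show "inj_on ?f (Sigma ?K ?C)"
    proof (rule inj_onI, clarsimp)
      fix k P k' P'
      assume P: "P \<in> pairings (S - {i, k})" "P' \<in> pairings (S - {i, k'})"
        "block_constant P u" "block_constant P' u"
        and eq: "insert {i, k} P = insert {i, k'} P'"
      have n: "{i, l} \<notin> P" "{i, l} \<notin> P'" for l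
      proof -
        have "\<forall>p\<in>P. i \<notin> p" by (rule notin[of P k]) (simp add: P)
        moreover have "\<forall>p\<in>P'. i \<notin> p" by (rule notin[of P' k']) (simp add: P)
        ultimately show "{i, l} \<notin> P" "{i, l} \<notin> P'" by blast+
      qed
      have "{i, k} \<in> insert {i, k'} P'" by (subst eq[symmetric]) simp
      then have "{i, k} = {i, k'}" using n by simp
      then have "k = k'" by (auto simp: doubleton_eq_iff)
      moreover from this have "P = P'" using eq n insert_ident[of "{i, k}" P P'] by simp
      ultimately show "k = k' \<and> P = P'" ..
    qed
    show "?f ` Sigma ?K ?C = {P \<in> pairings S. block_constant P u}"
    proof (intro equalityI subsetI)
      fix Q assume "Q \<in> ?f ` Sigma ?K ?C"
      then obtain k P where k: "k \<in> S" "k \<noteq> i" "u k = u i" and P: "P \<in> ?C k" and Q: "Q = insert {i, k} P"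
        by auto
      have "partition_on S Q"
        using P k assms(2) unfolding Q
        by (auto simp: pairings_def partition_on_def disjoint_def)
      then show "Q \<in> {P \<in> pairings S. block_constant P u}"
        using P k by (simp add: Q block_constant_insert_pair) (auto simp: pairings_def)
    next
      fix Q assume Q: "Q \<in> {P \<in> pairings S. block_constant P u}"
      then have part: "partition_on S Q" by (auto simp: pairings_def)
      define p where "p = block_of Q i"
      have p: "p \<in> Q" "i \<in> p" using block_of_mem[OF part assms(2)] by (auto simp: p_def)
      then have "card p = 2" using Q by (auto simp: pairings_def)
      then obtain k where k: "p = {i, k}" "k \<noteq> i" using p(2) by (auto simp: card_2_iff)
      have "k \<in> S" using part p k by (auto simp: partition_on_def)
      have rest: "partition_on (S - {i, k}) (Q - {p})"
      proof -
        have "q \<inter> p = {}" if "q \<in> Q - {p}" for q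
          using part p(1) that by (auto simp: partition_on_def disjoint_def)
        then have "\<Union>(Q - {p}) = \<Union>Q - p" using p(1) by blast
        with part k show ?thesis by (auto simp: partition_on_def disjoint_def)
      qed
      have ins: "Q = insert {i, k} (Q - {p})" using p k by auto
      have "u i = u k \<and> block_constant (Q - {p}) u"
        using Q block_constant_insert_pair[of i k "Q - {p}" u] by (simp flip: ins)
      moreover have "Q - {p} \<in> pairings (S - {i, k})" using rest Q by (auto simp: pairings_def)
      ultimately have "(k, Q - {p}) \<in> Sigma ?K ?C" using \<open>k \<in> S\<close> k by auto
      with ins show "Q \<in> ?f ` Sigma ?K ?C" by (intro image_eqI[where x = "(k, Q - {p})"]) auto
    qed
  qed
  then have "card {P \<in> pairings S. block_constant P u} = card (Sigma ?K ?C)"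
    by (rule bij_betw_same_card[symmetric])
  also have "\<dots> = (\<Sum>k\<in>?K. card (?C k))"
  proof (rule card_SigmaI)
    show "finite ?K" using assms(1) by simp
    have "finite (pairings (S - {i, k}))" for k using assms(1) by (intro finite_pairings) simp
    then show "\<forall>k\<in>?K. finite (?C k)" by simp
  qed
  finally show ?thesis .
qed

definition normal_moment :: "nat \<Rightarrow> real" where
  "normal_moment k = (\<integral>x. std_normal_density x * x ^ k \<partial>lborel)"

lemma normal_moment_simps [simp]:
  "normal_moment 0 = 1" "normal_moment (Suc 0) = 0"
  using integral_std_normal_moment_even[of 0] integral_std_normal_moment_odd[of 0]
  by (simp_all add: normal_moment_def)

text \<open>
  The moment recursion mirrors the recursion for pairings: among \<open>k + 2\<close> equal variables a given one has
  \<open>k + 1\<close> possible partners.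
\<close>

lemma normal_moment_Suc_Suc: "normal_moment (Suc (Suc k)) = real (Suc k) * normal_moment k"
proof (cases "even k")
  case True
  then obtain l where k: "k = 2 * l" by (elim evenE)
  have "Suc (Suc k) = 2 * Suc l" by (simp add: k)
  then show ?thesis
    unfolding normal_moment_def k
    by (simp only: integral_std_normal_moment_even) (simp add: k divide_simps)
next
  case False
  then obtain l where k: "k = 2 * l + 1" by (elim oddE)
  have "Suc (Suc k) = 2 * Suc l + 1" by (simp add: k)
  then show ?thesis
    unfolding normal_moment_def k by (simp only: integral_std_normal_moment_odd)
qed

text \<open>
  Wick's formula in combinatorial form, for independent standard normal variables indexed by \<open>V\<close> of
  which the \<open>i\<close>-th factor is the one with index \<open>u i\<close>. Fixing an element of \<open>S\<close> and pairing it off, both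
  sides satisfy the same recursion.
\<close>

lemma prod_normal_moment_eq_card_pairings:
  fixes u :: "'a \<Rightarrow> 'u"
  assumes "finite S" "finite V" "u ` S \<subseteq> V"
  shows "(\<Prod>v\<in>V. normal_moment (card {i\<in>S. u i = v})) = real (card {P \<in> pairings S. block_constant P u})"
  using assms
proof (induction "card S" arbitrary: S rule: less_induct)
  case less
  show ?case
  proof (cases "S = {}")
    case True
    have "{P \<in> pairings {}. block_constant P u} = {{}}"
      by (auto simp: pairings_def partition_on_def block_constant_def)
    then show ?thesis by (simp add: True)
  next
    case False
    then obtain i where i: "i \<in> S" by auto
    let ?K = "{k. k \<in> S - {i} \<and> u k = u i}"
    let ?m = "\<lambda>S v. normal_moment (card {j\<in>S. u j = v})"
    have finK: "finite ?K" using less.prems by simp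
    have ui: "u i \<in> V" using i less.prems by auto
    have split: "{j\<in>S. u j = u i} = insert i ?K" using i by auto
    have cardi: "card {j\<in>S. u j = u i} = Suc (card ?K)"
      unfolding split using finK by simp
    have step: "(\<Prod>v\<in>V. ?m (S - {i, k}) v) = normal_moment (card ?K - 1) * (\<Prod>v\<in>V - {u i}. ?m S v)"
      if k: "k \<in> ?K" for k
    proof -
      have "{j \<in> S - {i, k}. u j = u i} = ?K - {k}" by auto
      then have "?m (S - {i, k}) (u i) = normal_moment (card ?K - 1)" using k finK by simp
      moreover have "?m (S - {i, k}) v = ?m S v" if "v \<in> V - {u i}" for v
        using that k by (intro arg_cong[of _ _ normal_moment] arg_cong[of _ _ card]) auto
      ultimately show ?thesis
        by (simp add: prod.remove[OF less.prems(2) ui])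
    qed
    have "real (card {P \<in> pairings S. block_constant P u}) =
        (\<Sum>k\<in>?K. real (card {P \<in> pairings (S - {i, k}). block_constant P u}))"
      using card_pairings_rec[OF less.prems(1) i, of u] by simp
    also have "\<dots> = (\<Sum>k\<in>?K. \<Prod>v\<in>V. ?m (S - {i, k}) v)"
    proof (rule sum.cong[OF refl])
      fix k assume k: "k \<in> ?K"
      have "card (S - {i, k}) < card S" using i less.prems by (intro psubset_card_mono) auto
      then show "real (card {P \<in> pairings (S - {i, k}). block_constant P u}) = (\<Prod>v\<in>V. ?m (S - {i, k}) v)"
        using less.prems by (intro less.hyps[symmetric]) auto
    qed
    also have "\<dots> = real (card ?K) * normal_moment (card ?K - 1) * (\<Prod>v\<in>V - {u i}. ?m S v)"
      using step by simp
    \<comment> \<open>If no partner exists, the truncated subtraction is harmless because the factor \<open>card ?K\<close> is 0.\<close>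
    also have "real (card ?K) * normal_moment (card ?K - 1) = normal_moment (Suc (card ?K))"
      by (cases "card ?K") (auto simp: normal_moment_Suc_Suc)
    also have "\<dots> * (\<Prod>v\<in>V - {u i}. ?m S v) = (\<Prod>v\<in>V. ?m S v)"
      unfolding prod.remove[OF less.prems(2) ui, of "?m S"] cardi ..
    finally show ?thesis ..
  qed
qed

section \<open>Quaternion Gaussian variables\<close>

lemma (in prob_space) has_bochner_integral_normal_power:
  assumes "distributed M lborel \<xi> std_normal_density"
  shows "has_bochner_integral M (\<lambda>\<omega>. \<xi> \<omega> ^ k) (normal_moment k)"
proof -
  have "integrable lborel (\<lambda>x. std_normal_density x * x ^ k)"
    using integrable_normal_moment[of 1 0 k] by simp
  then show ?thesis
    using distributed_integrable[OF assms, of "\<lambda>x. x ^ k"] distributed_integral[OF assms, of "\<lambda>x. x ^ k"]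
    by (simp add: has_bochner_integral_iff normal_moment_def)
qed

lemma (in prob_space) has_bochner_integral_prod_indep:
  fixes X :: "'i \<Rightarrow> 'a \<Rightarrow> real"
  assumes "finite I" "indep_vars (\<lambda>_. borel) X I"
    and "\<And>i. i \<in> I \<Longrightarrow> has_bochner_integral M (X i) (r i)"
  shows "has_bochner_integral M (\<lambda>\<omega>. \<Prod>i\<in>I. X i \<omega>) (\<Prod>i\<in>I. r i)"
  using assms indep_vars_integrable[of I X] indep_vars_lebesgue_integral[of I X]
  by (simp add: has_bochner_integral_iff)

lemma (in prob_space) quat_gaussian_moment:
  assumes "std_quat_gaussian M Z"
  shows "has_bochner_integral M (\<lambda>\<omega>. \<Prod>e\<in>Basis. (Z \<omega> \<bullet> e) ^ d e) (\<Prod>e\<in>Basis. normal_moment (d e))"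
proof -
  obtain \<xi> :: "nat \<Rightarrow> 'a \<Rightarrow> real" where ind: "indep_vars (\<lambda>_. borel) \<xi> {0..3}"
    and dist: "\<And>l. l \<in> {0..3} \<Longrightarrow> distributed M lborel (\<xi> l) std_normal_density"
    and Z: "\<And>\<omega>. \<omega> \<in> space M \<Longrightarrow> Z \<omega> = Quat (\<xi> 0 \<omega>) (\<xi> 1 \<omega>) (\<xi> 2 \<omega>) (\<xi> 3 \<omega>)"
    using assms unfolding std_quat_gaussian_def by blast
  define \<epsilon> where "\<epsilon> l = [Quat 1 0 0 0, Quat 0 1 0 0, Quat 0 0 1 0, Quat 0 0 0 1] ! l" for l :: nat
  have four: "{0..3} = {0, 1, 2, 3 :: nat}" by auto
  have bij: "bij_betw \<epsilon> {0..3} Basis"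
    unfolding four bij_betw_def by (auto simp: \<epsilon>_def Basis_quat_def)
  have "indep_vars (\<lambda>_. borel) (\<lambda>l \<omega>. \<xi> l \<omega> ^ d (\<epsilon> l)) {0..3}"
    by (rule indep_vars_compose2[OF ind]) simp
  then have "has_bochner_integral M (\<lambda>\<omega>. \<Prod>l\<in>{0..3}. \<xi> l \<omega> ^ d (\<epsilon> l)) (\<Prod>l\<in>{0..3}. normal_moment (d (\<epsilon> l)))"
    using dist by (intro has_bochner_integral_prod_indep has_bochner_integral_normal_power) auto
  also have "(\<Prod>l\<in>{0..3}. normal_moment (d (\<epsilon> l))) = (\<Prod>e\<in>Basis. normal_moment (d e))"
    by (rule prod.reindex_bij_betw[OF bij])
  also have "has_bochner_integral M (\<lambda>\<omega>. \<Prod>l\<in>{0..3}. \<xi> l \<omega> ^ d (\<epsilon> l)) (\<Prod>e\<in>Basis. normal_moment (d e)) \<longleftrightarrow>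
      has_bochner_integral M (\<lambda>\<omega>. \<Prod>e\<in>Basis. (Z \<omega> \<bullet> e) ^ d e) (\<Prod>e\<in>Basis. normal_moment (d e))"
  proof (intro has_bochner_integral_cong refl)
    fix \<omega> assume "\<omega> \<in> space M"
    then have "\<xi> l \<omega> = Z \<omega> \<bullet> \<epsilon> l" if "l \<in> {0..3}" for l
      using that unfolding four by (auto simp: Z \<epsilon>_def inner_quat_def)
    then have "(\<Prod>l\<in>{0..3}. \<xi> l \<omega> ^ d (\<epsilon> l)) = (\<Prod>l\<in>{0..3}. (Z \<omega> \<bullet> \<epsilon> l) ^ d (\<epsilon> l))"
      by (intro prod.cong) auto
    also have "\<dots> = (\<Prod>e\<in>Basis. (Z \<omega> \<bullet> e) ^ d e)" by (rule prod.reindex_bij_betw[OF bij])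
    finally show "(\<Prod>l\<in>{0..3}. \<xi> l \<omega> ^ d (\<epsilon> l)) = (\<Prod>e\<in>Basis. (Z \<omega> \<bullet> e) ^ d e)" .
  qed
  finally show ?thesis .
qed

text \<open>
  Grouping the factors by the pair of variable index and coordinate turns the product into powers of
  independent standard normal variables.
\<close>

lemma (in prob_space) quat_wick:
  fixes Z :: "nat \<Rightarrow> 'a \<Rightarrow> quat"
  assumes Z: "\<And>k. std_quat_gaussian M (Z k)" and ind: "indep_vars (\<lambda>_. borel) Z UNIV"
    and S: "finite S" and a: "\<And>i. i \<in> S \<Longrightarrow> a i \<in> Basis"
  shows "has_bochner_integral M (\<lambda>\<omega>. \<Prod>i\<in>S. Z (c i) \<omega> \<bullet> a i)
    (real (card {P \<in> pairings S. block_constant P (\<lambda>i. (c i, a i))}))"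
proof -
  let ?d = "\<lambda>k e. card {i\<in>S. (c i, a i) = (k, e)}"
  have "indep_vars (\<lambda>_. borel) Z (c ` S)" using ind by (rule indep_vars_subset) simp
  then have "indep_vars (\<lambda>_. borel) (\<lambda>k \<omega>. \<Prod>e\<in>Basis. (Z k \<omega> \<bullet> e) ^ ?d k e) (c ` S)"
    by (rule indep_vars_compose2) simp
  then have "has_bochner_integral M (\<lambda>\<omega>. \<Prod>k\<in>c ` S. \<Prod>e\<in>Basis. (Z k \<omega> \<bullet> e) ^ ?d k e)
      (\<Prod>k\<in>c ` S. \<Prod>e\<in>Basis. normal_moment (?d k e))"
    using S Z by (intro has_bochner_integral_prod_indep quat_gaussian_moment) auto
  also have "(\<Prod>k\<in>c ` S. \<Prod>e\<in>Basis. normal_moment (?d k e)) =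
      (\<Prod>v\<in>c ` S \<times> Basis. normal_moment (card {i\<in>S. (c i, a i) = v}))"
    by (simp add: prod.cartesian_product case_prod_unfold prod_eq_iff)
  also have "\<dots> = real (card {P \<in> pairings S. block_constant P (\<lambda>i. (c i, a i))})"
    using S a by (intro prod_normal_moment_eq_card_pairings) auto
  also have "(\<lambda>\<omega>. \<Prod>k\<in>c ` S. \<Prod>e\<in>Basis. (Z k \<omega> \<bullet> e) ^ ?d k e) = (\<lambda>\<omega>. \<Prod>i\<in>S. Z (c i) \<omega> \<bullet> a i)"
  proof
    fix \<omega>
    have "(\<Prod>i\<in>S. Z (c i) \<omega> \<bullet> a i) =
        (\<Prod>v\<in>c ` S \<times> Basis. \<Prod>i\<in>{i\<in>S. (c i, a i) = v}. Z (c i) \<omega> \<bullet> a i)"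
      using S a by (intro prod.group[symmetric]) auto
    also have "\<dots> = (\<Prod>v\<in>c ` S \<times> Basis. (Z (fst v) \<omega> \<bullet> snd v) ^ card {i\<in>S. (c i, a i) = v})"
      by (intro prod.cong refl) (auto simp: prod_constant[symmetric] simp del: prod_constant intro!: prod.cong)
    also have "\<dots> = (\<Prod>k\<in>c ` S. \<Prod>e\<in>Basis. (Z k \<omega> \<bullet> e) ^ ?d k e)"
      by (simp add: prod.cartesian_product case_prod_unfold prod_eq_iff)
    finally show "(\<Prod>k\<in>c ` S. \<Prod>e\<in>Basis. (Z k \<omega> \<bullet> e) ^ ?d k e) = (\<Prod>i\<in>S. Z (c i) \<omega> \<bullet> a i)" ..
  qed
  finally show ?thesis .
qed

text \<open>
  The family of Moebius graphs is defined by equality of the chosen variables, so twisted and untwisted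
  edges exclude each other only because a Gaussian variable differs from its conjugate: otherwise its
  imaginary coordinate would vanish, although its second moment is 1.
\<close>

lemma (in prob_space) gaussian_neq_conj:
  assumes "std_quat_gaussian M Z"
  shows "Z \<noteq> (\<lambda>\<omega>. qcnj (Z \<omega>))"
proof
  assume "Z = (\<lambda>\<omega>. qcnj (Z \<omega>))"
  then have "Z \<omega> = qcnj (Z \<omega>)" for \<omega> by metis
  then have "qI (Z \<omega>) = - qI (Z \<omega>)" for \<omega> by (metis qcnj.simps(2))
  then have I: "Z \<omega> \<bullet> Quat 0 1 0 0 = 0" for \<omega> by (simp add: inner_quat_def)
  define d :: "quat \<Rightarrow> nat" where "d e = (if e = Quat 0 1 0 0 then 2 else 0)" for e
  have "has_bochner_integral M (\<lambda>\<omega>. \<Prod>e\<in>Basis. (Z \<omega> \<bullet> e) ^ d e) (\<Prod>e\<in>Basis. normal_moment (d e))"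
    by (rule quat_gaussian_moment[OF assms])
  moreover have "(\<Prod>e\<in>Basis. normal_moment (d e)) = 1"
    by (simp add: Basis_quat_def d_def numeral_2_eq_2 normal_moment_Suc_Suc)
  moreover have "(\<Prod>e\<in>Basis. (Z \<omega> \<bullet> e) ^ d e) = 0" for \<omega>
    by (simp add: Basis_quat_def d_def I)
  ultimately show False by (simp add: has_bochner_integral_iff)
qed

section \<open>Multilinear expansion\<close>

text \<open>
  The arguments are expanded one after the other; \<open>x\<close> holds the values at the remaining positions and has
  to vary in the induction, since the position treated last keeps its full sum in the meantime.
\<close>

lemma multilinear_expand:
  fixes F :: "('i \<Rightarrow> 'q :: real_vector) \<Rightarrow> real"
  assumes "finite S" "\<And>i x. i \<in> S \<Longrightarrow> linear (\<lambda>q. F (x(i := q)))"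
  shows "F (\<lambda>i. if i \<in> S then \<Sum>e\<in>B. t i e *\<^sub>R v i e else x i) =
    (\<Sum>a\<in>S \<rightarrow>\<^sub>E B. (\<Prod>i\<in>S. t i (a i)) * F (\<lambda>i. if i \<in> S then v i (a i) else x i))"
  using assms
proof (induction S arbitrary: x rule: finite_induct)
  case empty
  show ?case by simp
next
  case (insert j S)
  let ?q = "\<Sum>e\<in>B. t j e *\<^sub>R v j e"
  have "F (\<lambda>i. if i \<in> insert j S then \<Sum>e\<in>B. t i e *\<^sub>R v i e else x i) =
      F (\<lambda>i. if i \<in> S then \<Sum>e\<in>B. t i e *\<^sub>R v i e else (x(j := ?q)) i)"
    by (intro arg_cong[of _ _ F]) auto
  also have "\<dots> = (\<Sum>a\<in>S \<rightarrow>\<^sub>E B. (\<Prod>i\<in>S. t i (a i)) * F (\<lambda>i. if i \<in> S then v i (a i) else (x(j := ?q)) i))"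
    using insert.prems by (intro insert.IH) auto
  also have "\<dots> = (\<Sum>a\<in>S \<rightarrow>\<^sub>E B. \<Sum>e\<in>B. (\<Prod>i\<in>insert j S. t i ((a(j := e)) i)) *
      F (\<lambda>i. if i \<in> insert j S then v i ((a(j := e)) i) else x i))"
  proof (intro sum.cong refl)
    fix a
    let ?y = "\<lambda>i. if i \<in> S then v i (a i) else x i"
    have linear: "linear (\<lambda>q. F (?y(j := q)))" by (rule insert.prems) simp
    then have lin: "F (?y(j := ?q)) = (\<Sum>e\<in>B. t j e * F (?y(j := v j e)))"
      using linear_sum[OF linear, of "\<lambda>e. t j e *\<^sub>R v j e" B] linear_scale[OF linear]
      by (simp del: fun_upd_apply)
    have y: "(\<lambda>i. if i \<in> S then v i (a i) else (x(j := ?q)) i) = ?y(j := ?q)"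
      using insert.hyps by auto
    have prod: "(\<Prod>i\<in>insert j S. t i ((a(j := e)) i)) = t j e * (\<Prod>i\<in>S. t i (a i))" for e
      using insert.hyps by (simp, intro disjI2 prod.cong) auto
    have y': "(\<lambda>i. if i \<in> insert j S then v i ((a(j := e)) i) else x i) = ?y(j := v j e)" for e
      by auto
    show "(\<Prod>i\<in>S. t i (a i)) * F (\<lambda>i. if i \<in> S then v i (a i) else (x(j := ?q)) i) =
      (\<Sum>e\<in>B. (\<Prod>i\<in>insert j S. t i ((a(j := e)) i)) *
        F (\<lambda>i. if i \<in> insert j S then v i ((a(j := e)) i) else x i))"
      unfolding y y' lin prod by (simp add: sum_distrib_left mult_ac)
  qed
  also have "\<dots> = (\<Sum>a\<in>insert j S \<rightarrow>\<^sub>E B. (\<Prod>i\<in>insert j S. t i (a i)) *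
      F (\<lambda>i. if i \<in> insert j S then v i (a i) else x i))"
    using insert.hyps by (intro sum_PiE_insert[symmetric])
  finally show ?case .
qed

definition real_part_product :: "nat list list \<Rightarrow> (nat \<Rightarrow> quat) \<Rightarrow> real" where
  "real_part_product hs x = (\<Prod>h\<leftarrow>hs. qRe (\<Prod>i\<leftarrow>h. x i))"

lemma real_part_product_cong:
  assumes "\<And>i. i \<in> set (concat hs) \<Longrightarrow> x i = y i"
  shows "real_part_product hs x = real_part_product hs y"
  unfolding real_part_product_def
  using assms by (intro arg_cong[of _ _ prod_list] map_cong refl arg_cong[of _ _ qRe]) auto

text \<open>
  The half-edge \<open>j\<close> occurs at exactly one place of one word.
\<close>

lemma linear_real_part_product:
  assumes "distinct (concat hs)" "j \<in> set (concat hs)"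
  shows "linear (\<lambda>q. real_part_product hs (x(j := q)))"
proof -
  obtain h where h: "h \<in> set hs" "j \<in> set h" using assms(2) by auto
  obtain us vs where hs: "hs = us @ h # vs" using h(1) by (meson split_list)
  obtain A B where hAB: "h = A @ j # B" using h(2) by (meson split_list)
  have notin: "j \<notin> set A" "j \<notin> set B" "\<forall>w\<in>set us. j \<notin> set w" "\<forall>w\<in>set vs. j \<notin> set w"
    using assms(1) by (auto simp: hs hAB)
  have const: "real_part_product ws (x(j := q)) = real_part_product ws x" if "\<forall>w\<in>set ws. j \<notin> set w" for ws q
    using that by (intro real_part_product_cong) auto
  have "real_part_product hs (x(j := q)) = real_part_product us x * real_part_product vs x *
      qRe ((\<Prod>i\<leftarrow>A. x i) * q * (\<Prod>i\<leftarrow>B. x i))" for q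
  proof -
    have "real_part_product hs (x(j := q)) = real_part_product us (x(j := q)) *
        (qRe (\<Prod>i\<leftarrow>h. (x(j := q)) i) * real_part_product vs (x(j := q)))"
      by (simp add: real_part_product_def hs)
    also have "(\<Prod>i\<leftarrow>h. (x(j := q)) i) = (\<Prod>i\<leftarrow>A. x i) * q * (\<Prod>i\<leftarrow>B. x i)"
      using notin(1,2) by (simp add: hAB map_fun_upd mult.assoc del: fun_upd_apply) simp
    finally show ?thesis unfolding const[OF notin(3)] const[OF notin(4)] by (simp only: mult_ac)
  qed
  moreover have "linear (\<lambda>q. r * qRe (p * q * p'))" for r p p'
    by (rule linearI) (simp_all add: algebra_simps)
  ultimately show ?thesis by simp
qed

section \<open>Expansion over Moebius graphs\<close>

definition pairing_graph :: "nat list \<Rightarrow> (nat \<Rightarrow> bool) \<Rightarrow> nat set set \<Rightarrow> moebius_graph" where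
  "pairing_graph js b P = \<lparr>degrees = js, edges = P, twisted = {e \<in> P. \<forall>i\<in>e. \<forall>k\<in>e. b i = b k}\<rparr>"

lemma pairing_graph_simps [simp]:
  "degrees (pairing_graph js b P) = js" "edges (pairing_graph js b P) = P"
  "twisted (pairing_graph js b P) = {e \<in> P. \<forall>i\<in>e. \<forall>k\<in>e. b i = b k}"
  by (simp_all add: pairing_graph_def)

lemma is_moebius_graph_pairing_graph:
  assumes "\<forall>d\<in>set js. 0 < d" "P \<in> pairings {1..sum_list js}"
  shows "is_moebius_graph (pairing_graph js b P)"
  using assms by (auto simp: is_moebius_graph_def pairings_def)

lemma twisted_pairing_graph:
  "{i, k} \<in> P \<Longrightarrow> {i, k} \<in> twisted (pairing_graph js b P) \<longleftrightarrow> b i = b k"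
  by auto

lemma card_pairing:
  assumes "P \<in> pairings S" "finite S"
  shows "card S = 2 * card P"
proof -
  have P: "partition_on S P" and two: "\<And>p. p \<in> P \<Longrightarrow> card p = 2"
    using assms(1) by (auto simp: pairings_def)
  have "card S = (\<Sum>p\<in>P. card p)"
    using P assms(2) by (intro product_partition) (auto simp: partition_on_def intro: finite_subset)
  with two show ?thesis by simp
qed

text \<open>
  Passing from \<open>- 2 * qRe\<close> back to \<open>qRe\<close> at each of the \<open>m\<close> vertices leaves \<open>(-2) ^ (n + f - m)\<close>. As
  \<open>\<chi> = m - n + f\<close>, this exponent is \<open>2 * (n - m) + \<chi>\<close>.
\<close>

lemma sum_pairing_real_part:
  assumes pos: "\<forall>d\<in>set js. 0 < d" and P: "P \<in> pairings {1..sum_list js}"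
    and n: "sum_list js = 2 * n"
  shows "(\<Sum>a | a \<in> {1..2 * n} \<rightarrow>\<^sub>E Basis \<and> block_constant P a.
      real_part_product (vertex_words js) (\<lambda>i. if b i then a i else qcnj (a i))) =
    4 powi (int n - int (length js)) * (- 2) powi euler_char (pairing_graph js b P)"
proof -
  let ?G = "pairing_graph js b P"
  let ?A = "{a. a \<in> {1..2 * n} \<rightarrow>\<^sub>E Basis \<and> block_constant P a}"
  let ?F = "\<lambda>a. real_part_product (vertex_words js) (\<lambda>i. if b i then a i else qcnj (a i))"
  let ?m = "length js"
  have scale: "(\<Prod>h\<leftarrow>hs. - 2 * qRe (\<Prod>i\<leftarrow>h. x i)) = (- 2) ^ length hs * real_part_product hs x" for hs and x :: "nat \<Rightarrow> quat"
    by (induction hs) (auto simp: real_part_product_def)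
  have len: "length (vertex_words js) = ?m" by (simp add: vertex_words_def)
  have cardP: "card P = n" using card_pairing[OF P] n by simp
  have "(- 2) ^ ?m * (\<Sum>a\<in>?A. ?F a) = (\<Sum>a\<in>?A. \<Prod>h\<leftarrow>vertex_words js. - 2 * qRe (\<Prod>i\<leftarrow>h. if b i then a i else qcnj (a i)))"
    unfolding scale len by (rule sum_distrib_left)
  also have "\<dots> = (- 2) ^ (n + card (faces ?G))"
    using sum_pairing_quat[OF is_moebius_graph_pairing_graph[OF pos P], of b b] n cardP by auto
  finally have "(\<Sum>a\<in>?A. ?F a) = (- 2) ^ (n + card (faces ?G)) / (- 2) ^ ?m" by (simp add: field_simps)
  also have "\<dots> = (- 2) powi (int n + int (card (faces ?G)) - int ?m)"
    by (simp add: power_int_diff power_int_add power_add)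
  also have "\<dots> = (- 2) powi (2 * (int n - int ?m)) * (- 2) powi euler_char ?G"
    by (subst power_int_add[symmetric]) (simp_all add: euler_char_def cardP)
  also have "(- 2 :: real) powi (2 * (int n - int ?m)) = 4 powi (int n - int ?m)"
    unfolding power_int_mult by simp
  finally show ?thesis .
qed

text \<open>
  A graph in the family is determined by its edges: by \<open>gaussian_neq_conj\<close>, used here through the
  assumption on \<open>Z\<close>, an edge can be twisted only if both ends carry the same choice between a variable
  and its conjugate, and must be twisted then.
\<close>

lemma bij_betw_moebius_family:
  fixes Z X :: "nat \<Rightarrow> 'a \<Rightarrow> quat"
  assumes pos: "\<forall>d\<in>set js. 0 < d"
    and X: "\<And>i. i \<in> {1..sum_list js} \<Longrightarrow> X i = Z (c i) \<or> X i = (\<lambda>\<omega>. qcnj (Z (c i) \<omega>))"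
    and Z: "\<And>k. Z k \<noteq> (\<lambda>\<omega>. qcnj (Z k \<omega>))"
  defines "b \<equiv> \<lambda>i. X i = Z (c i)"
  shows "bij_betw (pairing_graph js b) {P \<in> pairings {1..sum_list js}. block_constant P c} (moebius_family js c X)"
proof -
  let ?S = "{1..sum_list js}"
  have conj: "qcnj (qcnj q) = q" for q by (simp add: quat_eq_iff)
  have bX: "X i = (if b i then Z (c i) else (\<lambda>\<omega>. qcnj (Z (c i) \<omega>)))" if "i \<in> ?S" for i
    using X[OF that] by (auto simp: b_def)
  have same: "X i = X k \<longleftrightarrow> b i = b k"
    and opposite: "X i = (\<lambda>\<omega>. qcnj (X k \<omega>)) \<longleftrightarrow> b i \<noteq> b k"
    if "i \<in> ?S" "k \<in> ?S" "c i = c k" for i k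
  proof -
    define z where "z = Z (c k)"
    define z' where "z' = (\<lambda>\<omega>. qcnj (z \<omega>))"
    have i: "X i = (if b i then z else z')" and k: "X k = (if b k then z else z')"
      using bX[OF that(1)] bX[OF that(2)] that(3) by (simp_all add: z_def z'_def)
    have neq: "z \<noteq> z'" unfolding z'_def z_def by (rule Z)
    have conj_k: "(\<lambda>\<omega>. qcnj (X k \<omega>)) = (if b k then z' else z)"
      unfolding k z'_def by (cases "b k") (simp_all only: if_True if_False conj)
    show "X i = X k \<longleftrightarrow> b i = b k" unfolding i k using neq by auto
    show "X i = (\<lambda>\<omega>. qcnj (X k \<omega>)) \<longleftrightarrow> b i \<noteq> b k" unfolding conj_k unfolding i using neq by auto
  qed
  have mem: "i \<in> ?S" "k \<in> ?S" if "partition_on ?S P" "{i, k} \<in> P" for i k P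
    using that by (auto simp: partition_on_def)
  show ?thesis
  \<comment> \<open>The twisted set can be reconstructed, so forgetting it is the inverse.\<close>
  proof (rule bij_betwI[where g = edges])
    show "pairing_graph js b \<in> {P \<in> pairings ?S. block_constant P c} \<rightarrow> moebius_family js c X"
    proof
      fix P assume P: "P \<in> {P \<in> pairings ?S. block_constant P c}"
      then have part: "partition_on ?S P" by (auto simp: pairings_def)
      have "c i = c k \<and> (if {i, k} \<in> twisted (pairing_graph js b P) then X i = X k else X i = (\<lambda>\<omega>. qcnj (X k \<omega>)))"
        if e: "{i, k} \<in> P" for i k
      proof -
        have "c i = c k" using P e by (auto simp: block_constant_def)
        then show ?thesis
          using same[OF mem[OF part e]] opposite[OF mem[OF part e]] twisted_pairing_graph[OF e] by auto
      qed
      then have "\<forall>i k. {i, k} \<in> edges (pairing_graph js b P) \<longrightarrow> c i = c k \<and>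
          (if {i, k} \<in> twisted (pairing_graph js b P) then X i = X k else X i = (\<lambda>\<omega>. qcnj (X k \<omega>)))"
        unfolding pairing_graph_simps(2) by blast
      moreover have "is_moebius_graph (pairing_graph js b P)"
        using P by (intro is_moebius_graph_pairing_graph[OF pos]) simp
      ultimately show "pairing_graph js b P \<in> moebius_family js c X"
        unfolding moebius_family_def mem_Collect_eq by (intro conjI pairing_graph_simps(1))
    qed
  next
    have edge: "edges G \<in> pairings ?S \<and> block_constant (edges G) c \<and> pairing_graph js b (edges G) = G"
      if G: "G \<in> moebius_family js c X" for G
    proof -
      have deg: "degrees G = js" and pair: "edges G \<in> pairings ?S" and sub: "twisted G \<subseteq> edges G"
        and part: "partition_on ?S (edges G)"
        using G unfolding moebius_family_def is_moebius_graph_def pairings_def by blast+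
      have e: "c i = c k" "if {i, k} \<in> twisted G then X i = X k else X i = (\<lambda>\<omega>. qcnj (X k \<omega>))"
        if "{i, k} \<in> edges G" for i k
        using G that unfolding moebius_family_def by blast+
      have tw: "e \<in> twisted G \<longleftrightarrow> (\<forall>i\<in>e. \<forall>k\<in>e. b i = b k)" and cc: "\<forall>i\<in>e. \<forall>k\<in>e. c i = c k"
        if eG: "e \<in> edges G" for e
      proof -
        have "card e = 2" using pair eG by (auto simp: pairings_def)
        then obtain i k where ik: "e = {i, k}" by (auto simp: card_2_iff)
        with eG have ikG: "{i, k} \<in> edges G" by simp
        have "{i, k} \<in> twisted G \<longleftrightarrow> b i = b k"
          using e(2)[OF ikG] same[OF mem[OF part ikG] e(1)[OF ikG]] opposite[OF mem[OF part ikG] e(1)[OF ikG]]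
          by argo
        then show "e \<in> twisted G \<longleftrightarrow> (\<forall>i\<in>e. \<forall>k\<in>e. b i = b k)" unfolding ik by auto
        show "\<forall>i\<in>e. \<forall>k\<in>e. c i = c k" unfolding ik using e(1)[OF ikG] by auto
      qed
      have "twisted G = {e \<in> edges G. \<forall>i\<in>e. \<forall>k\<in>e. b i = b k}" using tw sub by blast
      then have "pairing_graph js b (edges G) = G"
        using deg by (simp add: pairing_graph_def)
      with pair cc show ?thesis unfolding block_constant_def by blast
    qed
    then show "edges \<in> moebius_family js c X \<rightarrow> {P \<in> pairings ?S. block_constant P c}" by auto
    show "edges (pairing_graph js b P) = P" for P by simp
    show "pairing_graph js b (edges G) = G" if "G \<in> moebius_family js c X" for G
      using edge that by blast
  qed
qed

theorem theorem3p1: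
  fixes M :: "'a measure" and Z X :: "nat \<Rightarrow> 'a \<Rightarrow> quat"
    and c :: "nat \<Rightarrow> nat" and n :: nat and js :: "nat list"
  assumes "prob_space M"
    and "\<And>k. std_quat_gaussian M (Z k)"
    and "prob_space.indep_vars M (\<lambda>_. borel) Z UNIV"
    and "\<And>i. i \<in> {1..2 * n} \<Longrightarrow> X i = Z (c i) \<or> X i = (\<lambda>\<omega>. qcnj (Z (c i) \<omega>))"
    and "\<And>j. j \<in> set js \<Longrightarrow> 0 < j"
    and "sum_list js = 2 * n"
  shows "(\<integral>\<omega>. (\<Prod>r<length js. qRe (prod_list (map (\<lambda>i. X i \<omega>) (half_edges js r)))) \<partial>M) =
         4 powi (int n - int (length js)) *
         (\<Sum>G\<in>moebius_family js c X. (-2) powi euler_char G)"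
proof -
  interpret prob_space M by (rule assms(1))
  let ?S = "{1..2 * n}"
  let ?Q = "{P \<in> pairings ?S. block_constant P c}"
  define b where "b = (\<lambda>i. X i = Z (c i))"
  let ?F = "real_part_product (vertex_words js)"
  let ?s = "\<lambda>i q. if b i then q else qcnj q"
  have pos: "\<forall>d\<in>set js. 0 < d" using assms(5) by blast
  have dist: "distinct (concat (vertex_words js))" and set: "set (concat (vertex_words js)) = ?S"
    by (auto simp: concat_vertex_words assms(6))
  have finQ: "finite ?Q" using finite_pairings[of ?S] by simp
  have fin_assign: "finite (?S \<rightarrow>\<^sub>E (Basis :: quat set))" by (intro finite_PiE) auto
  have expand: "(\<Prod>r<length js. qRe (prod_list (map (\<lambda>i. X i \<omega>) (half_edges js r)))) =
      (\<Sum>a\<in>?S \<rightarrow>\<^sub>E Basis. (\<Prod>i\<in>?S. Z (c i) \<omega> \<bullet> a i) * ?F (\<lambda>i. ?s i (a i)))" for \<omega>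
  proof -
    have "(\<Prod>r<length js. qRe (prod_list (map (\<lambda>i. X i \<omega>) (half_edges js r)))) = ?F (\<lambda>i. X i \<omega>)"
      unfolding real_part_product_def vertex_words_def
      by (simp add: prod.list_conv_set_nth lessThan_atLeast0)
    also have "\<dots> = ?F (\<lambda>i. if i \<in> ?S then \<Sum>e\<in>Basis. (Z (c i) \<omega> \<bullet> e) *\<^sub>R ?s i e else 0)"
    proof (rule real_part_product_cong)
      fix i assume "i \<in> set (concat (vertex_words js))"
      then have i: "i \<in> ?S" unfolding set .
      have "X i \<omega> = ?s i (Z (c i) \<omega>)" using assms(4)[OF i] by (auto simp: b_def)
      also have "\<dots> = (\<Sum>e\<in>Basis. (Z (c i) \<omega> \<bullet> e) *\<^sub>R ?s i e)"
        by (simp add: sum_Basis_quat quat_eq_iff inner_quat_def)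
      finally show "X i \<omega> = (if i \<in> ?S then \<Sum>e\<in>Basis. (Z (c i) \<omega> \<bullet> e) *\<^sub>R ?s i e else 0)"
        using i by simp
    qed
    also have "\<dots> = (\<Sum>a\<in>?S \<rightarrow>\<^sub>E Basis. (\<Prod>i\<in>?S. Z (c i) \<omega> \<bullet> a i) * ?F (\<lambda>i. if i \<in> ?S then ?s i (a i) else 0))"
      by (rule multilinear_expand) (simp, rule linear_real_part_product[OF dist], simp only: set)
    also have "\<dots> = (\<Sum>a\<in>?S \<rightarrow>\<^sub>E Basis. (\<Prod>i\<in>?S. Z (c i) \<omega> \<bullet> a i) * ?F (\<lambda>i. ?s i (a i)))"
      by (intro sum.cong refl arg_cong2[of _ _ _ _ "(*)"] real_part_product_cong)
        (simp only: set if_True)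
    finally show ?thesis .
  qed
  have wick: "has_bochner_integral M (\<lambda>\<omega>. \<Prod>i\<in>?S. Z (c i) \<omega> \<bullet> a i) (\<Sum>P\<in>?Q. of_bool (block_constant P a))"
    if a: "a \<in> ?S \<rightarrow>\<^sub>E Basis" for a
  proof -
    \<comment> \<open>Wick pairs coordinates of variables; the condition on the variable does not involve the labelling.\<close>
    have "{P \<in> pairings ?S. block_constant P (\<lambda>i. (c i, a i))} = {P \<in> ?Q. block_constant P a}"
      unfolding block_constant_def prod.inject by blast
    then have "real (card {P \<in> pairings ?S. block_constant P (\<lambda>i. (c i, a i))}) = (\<Sum>P\<in>?Q. of_bool (block_constant P a))"
      using finQ by (simp add: sum_of_bool_eq Int_def)
    then show ?thesis using quat_wick[OF assms(2,3), of ?S a c] a by (auto simp: PiE_iff)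
  qed
  have "has_bochner_integral M (\<lambda>\<omega>. \<Sum>a\<in>?S \<rightarrow>\<^sub>E Basis. (\<Prod>i\<in>?S. Z (c i) \<omega> \<bullet> a i) * ?F (\<lambda>i. ?s i (a i)))
      (\<Sum>a\<in>?S \<rightarrow>\<^sub>E Basis. (\<Sum>P\<in>?Q. of_bool (block_constant P a)) * ?F (\<lambda>i. ?s i (a i)))"
    by (intro has_bochner_integral_sum has_bochner_integral_mult_left wick)
  then have "(\<integral>\<omega>. (\<Prod>r<length js. qRe (prod_list (map (\<lambda>i. X i \<omega>) (half_edges js r)))) \<partial>M) =
      (\<Sum>a\<in>?S \<rightarrow>\<^sub>E Basis. (\<Sum>P\<in>?Q. of_bool (block_constant P a)) * ?F (\<lambda>i. ?s i (a i)))"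
    unfolding expand by (rule has_bochner_integral_integral_eq)
  also have "\<dots> = (\<Sum>P\<in>?Q. \<Sum>a\<in>?S \<rightarrow>\<^sub>E Basis. of_bool (block_constant P a) * ?F (\<lambda>i. ?s i (a i)))"
    unfolding sum_distrib_right by (rule sum.swap)
  also have "\<dots> = (\<Sum>P\<in>?Q. \<Sum>a | a \<in> ?S \<rightarrow>\<^sub>E Basis \<and> block_constant P a. ?F (\<lambda>i. ?s i (a i)))"
    using fin_assign by (intro sum.cong refl sum.mono_neutral_cong_right) auto
  also have "\<dots> = (\<Sum>P\<in>?Q. 4 powi (int n - int (length js)) * (- 2) powi euler_char (pairing_graph js b P))"
    using pos assms(6) by (intro sum.cong refl sum_pairing_real_part) auto
  also have "\<dots> = 4 powi (int n - int (length js)) * (\<Sum>P\<in>?Q. (- 2) powi euler_char (pairing_graph js b P))"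
    by (rule sum_distrib_left[symmetric])
  also have "(\<Sum>P\<in>?Q. (- 2) powi euler_char (pairing_graph js b P)) = (\<Sum>G\<in>moebius_family js c X. (- 2) powi euler_char G)"
  proof (rule sum.reindex_bij_betw)
    show "bij_betw (pairing_graph js b) ?Q (moebius_family js c X)"
      using bij_betw_moebius_family[OF pos, of X Z c] assms(4) gaussian_neq_conj[OF assms(2)]
      unfolding b_def assms(6) by blast
  qed
  finally show ?thesis .
qed

end
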